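(* Let $X, X_1, X_2, \dots$ be independent and identically distributed, non-normal real-valued random variables with $\mathbb{E}X^4<\infty$, distribution function $F$ and Lebesgue density $p$. Further, assume $\sup_{s\in\mathbb{R}}|s\,p(s)|<\infty$ and (without loss of generality, by affine invariance of the statistic) $\mathbb{E}X=0$, $\mathbb{V}(X)=1$. Then, as $n\to\infty$, $$\sqrt{n}\left(\frac{G_n^{(2)}}{n}-\Delta^{(2)}\right)\stackrel{\mathcal{D}}{\longrightarrow}\mathcal{N}\big(0,\tau_{(2)}^2\big),$$ where $$\tau_{(2)}^2=4\int_{\mathbb{R}}\int_{\mathbb{R}}\mathcal{C}^{(2)}(s,t)\big(F^X(s)-\Phi(s)\big)\big(F^X(t)-\Phi(t)\big)\,\omega(s)\,\omega(t)\,\mathrm{d}s\,\mathrm{d}t$$ with $\mathcal{C}^{(2)}(s,t)=\mathbb{E}\big[C^{(2)}(s)\,C^{(2)}(t)\big]$, $s,t\in\mathbb{R}$, and $$\begin{aligned}C^{(2)}(s)=\;&X(X-s)\mathds{1}\{X\le s\}-X\,\mathbb{E}\big[(X-s)\mathds{1}\{X\le s\}\big]\\&-X^2F^X(s)-\Big(\tfrac12(1-X^2)\cdot s-X\Big)d^X(s),\quad s\in\mathbb{R}.\end{aligned}$$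
   Context: $\omega:\mathbb{R}\to\mathbb{R}$ is a positive continuous weight function with $\int_{\mathbb{R}}t^4\,\omega(t)\,\mathrm{d}t<\infty$. $\Phi$ is the standard normal distribution function. The zero-bias distribution of $X$ has density $d^X(t)=\mathbb{E}[X\mathds{1}\{X>t\}]=-\mathbb{E}[X\mathds{1}\{X\le t\}]$ and distribution function $F^X(t)=\mathbb{E}[X(X-t)\mathds{1}\{X\le t\}]$. The sample mean and variance are $\overline{X}_n=n^{-1}\sum_{k=1}^n X_k$ and $S_n^2=n^{-1}\sum_{k=1}^n(X_k-\overline{X}_n)^2$, and $Y_{n,j}=(X_j-\overline{X}_n)/S_n$, $j=1,\dots,n$. The test statistic is $$G_n^{(2)}=n\int_{\mathbb{R}}\Big(\frac1n\sum_{j=1}^nY_{n,j}(Y_{n,j}-t)\mathds{1}\{Y_{n,j}\le t\}-\Phi(t)\Big)^2\omega(t)\,\mathrm{d}t,$$ and $\Delta^{(2)}=\int_{\mathbb{R}}(F^X(s)-\Phi(s))^2\,\omega(s)\,\mathrm{d}s$. $\stackrel{\mathcal{D}}{\longrightarrow}$ denotes convergence in distribution. *)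

theory Defs
  imports "HOL-Probability.Probability"
begin

text \<open>The normal law with mean \<open>\<mu>\<close> and variance \<open>v\<close>. The variance \<open>v = 0\<close> is allowed
  and gives the point mass at \<open>\<mu>\<close>.\<close>

definition normal_law :: "real \<Rightarrow> real \<Rightarrow> real measure" where
  "normal_law \<mu> v =
     (if v = 0 then return borel \<mu> else density lborel (normal_density \<mu> (sqrt v)))"

abbreviation std_normal_cdf :: "real \<Rightarrow> real" (\<open>\<Phi>\<close>) where
  "\<Phi> \<equiv> cdf std_normal_distribution"

text \<open>Density and distribution function of the zero-bias distribution of \<open>X\<close>; these are the
  formulas for a centred \<open>X\<close> with unit variance.\<close>

definition zb_density :: "'a measure \<Rightarrow> ('a \<Rightarrow> real) \<Rightarrow> real \<Rightarrow> real" where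
  "zb_density M X t = prob_space.expectation M (\<lambda>\<xi>. X \<xi> * indicator {t<..} (X \<xi>))"

definition zb_cdf :: "'a measure \<Rightarrow> ('a \<Rightarrow> real) \<Rightarrow> real \<Rightarrow> real" where
  "zb_cdf M X t = prob_space.expectation M (\<lambda>\<xi>. X \<xi> * (X \<xi> - t) * indicator {..t} (X \<xi>))"

text \<open>A sample of size \<open>n\<close> is given by the values \<open>x 0, \<dots>, x (n - 1)\<close>.\<close>

definition sample_mean :: "nat \<Rightarrow> (nat \<Rightarrow> real) \<Rightarrow> real" where
  "sample_mean n x = (\<Sum>k<n. x k) / real n"

definition sample_var :: "nat \<Rightarrow> (nat \<Rightarrow> real) \<Rightarrow> real" where
  "sample_var n x = (\<Sum>k<n. (x k - sample_mean n x)\<^sup>2) / real n"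

definition scaled_residual :: "nat \<Rightarrow> (nat \<Rightarrow> real) \<Rightarrow> nat \<Rightarrow> real" where
  "scaled_residual n x j = (x j - sample_mean n x) / sqrt (sample_var n x)"

definition G2 :: "(real \<Rightarrow> real) \<Rightarrow> nat \<Rightarrow> (nat \<Rightarrow> real) \<Rightarrow> real" where
  "G2 w n x = real n * (LINT t|lborel.
     ((\<Sum>j<n. scaled_residual n x j * (scaled_residual n x j - t)
          * indicator {..t} (scaled_residual n x j)) / real n - \<Phi> t)\<^sup>2 * w t)"

definition Delta2 :: "'a measure \<Rightarrow> (real \<Rightarrow> real) \<Rightarrow> ('a \<Rightarrow> real) \<Rightarrow> real" where
  "Delta2 M w X = (LINT s|lborel. (zb_cdf M X s - \<Phi> s)\<^sup>2 * w s)"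

definition C2 :: "'a measure \<Rightarrow> ('a \<Rightarrow> real) \<Rightarrow> real \<Rightarrow> 'a \<Rightarrow> real" where
  "C2 M X s \<xi> =
     X \<xi> * (X \<xi> - s) * indicator {..s} (X \<xi>)
     - X \<xi> * prob_space.expectation M (\<lambda>\<eta>. (X \<eta> - s) * indicator {..s} (X \<eta>))
     - (X \<xi>)\<^sup>2 * zb_cdf M X s
     - (1/2 * (1 - (X \<xi>)\<^sup>2) * s - X \<xi>) * zb_density M X s"

definition cov_kernel2 :: "'a measure \<Rightarrow> ('a \<Rightarrow> real) \<Rightarrow> real \<Rightarrow> real \<Rightarrow> real" where
  "cov_kernel2 M X s t = prob_space.expectation M (\<lambda>\<xi>. C2 M X s \<xi> * C2 M X t \<xi>)"

definition tau2_sq :: "'a measure \<Rightarrow> (real \<Rightarrow> real) \<Rightarrow> ('a \<Rightarrow> real) \<Rightarrow> real" where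
  "tau2_sq M w X = 4 * (LINT s|lborel. LINT t|lborel.
     cov_kernel2 M X s t * (zb_cdf M X s - \<Phi> s) * (zb_cdf M X t - \<Phi> t) * w s * w t)"

end

theory Submission
  imports Defs
begin

text \<open>Write \<open>F\<^sub>n\<close> for the empirical zero-bias distribution function of the residuals,
  \<open>H = zb_cdf M X\<close> and \<open>L\<^sub>n(t)\<close> for the sample mean of the influence function \<open>C2\<close> at \<open>t\<close>.
  Since \<open>(F\<^sub>n - \<Phi>)\<^sup>2 - (H - \<Phi>)\<^sup>2 = 2 L\<^sub>n (H - \<Phi>) + 2 (F\<^sub>n - H - L\<^sub>n) (H - \<Phi>) + (F\<^sub>n - H)\<^sup>2\<close>,
  the statistic is a normalized sum of i.i.d. terms, to which the central limit theorem applies,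
  plus \<open>\<surd>n\<close> times the weighted integral of the last two summands. On the event that the sample mean and
  the deviation of the second sample moment from \<open>1\<close> are at most \<open>\<delta>\<close>, these summands are bounded by a
  random function of \<open>t\<close> with expectation \<open>O(\<delta>\<^sup>2 (1 + |t|)\<^sup>2)\<close>, as long as \<open>1/n \<le> \<delta>\<^sup>2\<close>. The point is that
  replacing the threshold \<open>t\<close> by the random threshold \<open>mean + sd * t\<close> only affects the observations
  within distance \<open>\<eta> = O(\<delta> (1 + |t|))\<close> of \<open>t\<close>, and these contribute \<open>O(\<eta>\<^sup>2)\<close> because \<open>s p(s)\<close> is bounded; no
  maximal inequality for empirical processes is needed. With \<open>\<delta> = n powr (- 3 / 8)\<close> the exceptional
  event has probability \<open>O(1 / (n \<delta>\<^sup>2))\<close> and the remainder has expectation \<open>O(\<surd>n \<delta>\<^sup>2)\<close>; both are of order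
  \<open>n powr (- 1 / 4)\<close>.\<close>

section \<open>Weak convergence\<close>

lemma cmod_iexp_minus_one: "cmod (iexp y - 1) \<le> \<bar>y\<bar>"
  using iexp_approx1[of y 0] by simp

lemma cmod_iexp_diff: "cmod (iexp a - iexp b) \<le> min 2 \<bar>a - b\<bar>"
proof -
  have "iexp a - iexp b = iexp b * (iexp (a - b) - 1)"
    by (simp add: algebra_simps exp_diff)
  then have "cmod (iexp a - iexp b) = cmod (iexp (a - b) - 1)"
    by (simp add: norm_mult)
  moreover have "cmod (iexp a - iexp b) \<le> 2"
    using norm_triangle_ineq4[of "iexp a" "iexp b"] by simp
  ultimately show ?thesis
    using cmod_iexp_minus_one[of "a - b"] by simp
qed

text \<open>Characteristic functions of the two laws differ by at most E |iexp(t B) - iexp(t A)|.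
  Splitting at distance e bounds this by 2 times the probability of a gap above e, plus |t| e, and
  Levy's continuity theorem applies.\<close>

lemma (in prob_space) weak_conv_m_close_in_probability:
  fixes A B :: "nat \<Rightarrow> 'a \<Rightarrow> real"
  assumes A[measurable]: "\<And>n. A n \<in> borel_measurable M"
    and B[measurable]: "\<And>n. B n \<in> borel_measurable M"
    and \<nu>: "real_distribution \<nu>"
    and conv: "weak_conv_m (\<lambda>n. distr M borel (A n)) \<nu>"
    and close: "\<And>e. 0 < e \<Longrightarrow> (\<lambda>n. prob {\<xi>\<in>space M. e < \<bar>B n \<xi> - A n \<xi>\<bar>}) \<longlonglongrightarrow> 0"
  shows "weak_conv_m (\<lambda>n. distr M borel (B n)) \<nu>"
proof (rule levy_continuity)
  show "real_distribution (distr M borel (B n))" for n by simp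
  show "real_distribution \<nu>" by fact
  fix t
  have char_A: "(\<lambda>n. char (distr M borel (A n)) t) \<longlonglongrightarrow> char \<nu> t"
    by (rule levy_continuity1[OF _ \<nu> conv]) simp
  have bound: "cmod (char (distr M borel (B n)) t - char (distr M borel (A n)) t)
      \<le> 2 * prob {\<xi>\<in>space M. e < \<bar>B n \<xi> - A n \<xi>\<bar>} + \<bar>t\<bar> * e" if "0 < e" for n e
  proof -
    let ?S = "{\<xi>\<in>space M. e < \<bar>B n \<xi> - A n \<xi>\<bar>}"
    have int: "integrable M (\<lambda>\<xi>. iexp (t * f \<xi>))"
      if [measurable]: "f \<in> borel_measurable M" for f
      by (rule integrable_iexp) auto
    have "char (distr M borel (B n)) t - char (distr M borel (A n)) t
        = (LINT \<xi>|M. iexp (t * B n \<xi>) - iexp (t * A n \<xi>))"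
      using int[OF A[of n]] int[OF B[of n]] by (simp add: char_def integral_distr)
    also have "cmod \<dots> \<le> (LINT \<xi>|M. 2 * indicator ?S \<xi> + \<bar>t\<bar> * e)"
    proof (rule order_trans[OF integral_norm_bound integral_mono])
      show "integrable M (\<lambda>\<xi>. cmod (iexp (t * B n \<xi>) - iexp (t * A n \<xi>)))"
        using int[OF A[of n]] int[OF B[of n]] by (intro integrable_norm Bochner_Integration.integrable_diff)
      show "integrable M (\<lambda>\<xi>. 2 * indicator ?S \<xi> + \<bar>t\<bar> * e :: real)"
        by (intro Bochner_Integration.integrable_add integrable_mult_right integrable_real_indicator)
           (auto simp: less_top[symmetric])
      fix \<xi> assume "\<xi> \<in> space M"
      have *: "cmod (iexp (t * B n \<xi>) - iexp (t * A n \<xi>)) \<le> min 2 (\<bar>t\<bar> * \<bar>B n \<xi> - A n \<xi>\<bar>)"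
        using cmod_iexp_diff[of "t * B n \<xi>" "t * A n \<xi>"]
        by (simp add: abs_mult[symmetric] right_diff_distrib)
      show "cmod (iexp (t * B n \<xi>) - iexp (t * A n \<xi>)) \<le> 2 * indicator ?S \<xi> + \<bar>t\<bar> * e"
      proof (cases "\<xi> \<in> ?S")
        case True
        have "cmod (iexp (t * B n \<xi>) - iexp (t * A n \<xi>)) \<le> 2" using * by linarith
        moreover have "0 \<le> \<bar>t\<bar> * e" using that by simp
        ultimately show ?thesis using True by simp
      next
        case False
        with \<open>\<xi> \<in> space M\<close> have "\<bar>B n \<xi> - A n \<xi>\<bar> \<le> e" by auto
        then have "\<bar>t\<bar> * \<bar>B n \<xi> - A n \<xi>\<bar> \<le> \<bar>t\<bar> * e" by (intro mult_left_mono) auto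
        with * False show ?thesis by simp
      qed
    qed
    also have "\<dots> = 2 * prob ?S + \<bar>t\<bar> * e"
      by (subst Bochner_Integration.integral_add)
         (auto simp: prob_space less_top[symmetric] intro!: integrable_mult_right integrable_real_indicator)
    finally show ?thesis .
  qed
  have "(\<lambda>n. char (distr M borel (B n)) t - char (distr M borel (A n)) t) \<longlonglongrightarrow> 0"
  proof (rule LIMSEQ_I)
    fix r :: real assume r: "0 < r"
    \<comment> \<open>Each half of the bound gets r / 2: |t| e by this choice, where the + 1 covers
      t = 0, and twice the probability once it is below r / 4.\<close>
    define e where "e = r / (2 * (\<bar>t\<bar> + 1))"
    have e: "0 < e" "\<bar>t\<bar> * e \<le> r / 2"
      using r by (auto simp: e_def field_simps)
    from LIMSEQ_D[OF close[OF e(1)], of "r / 4"] r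
    obtain N where N: "\<And>n. n \<ge> N \<Longrightarrow> prob {\<xi>\<in>space M. e < \<bar>B n \<xi> - A n \<xi>\<bar>} < r / 4" by auto
    show "\<exists>no. \<forall>n\<ge>no. norm (char (distr M borel (B n)) t - char (distr M borel (A n)) t - 0) < r"
    proof (intro exI allI impI)
      fix n assume "n \<ge> N"
      then show "norm (char (distr M borel (B n)) t - char (distr M borel (A n)) t - 0) < r"
        using bound[OF e(1), of n] N[of n] e(2) by simp
    qed
  qed
  from tendsto_add[OF this char_A] show "(\<lambda>n. char (distr M borel (B n)) t) \<longlonglongrightarrow> char \<nu> t" by simp
qed

lemma normal_law_eq_distr:
  assumes "0 \<le> v"
  shows "normal_law 0 v = distr std_normal_distribution borel (\<lambda>x. sqrt v * x)"
proof (cases "v = 0")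
  case True
  interpret real_distribution std_normal_distribution by (rule real_dist_normal_dist)
  show ?thesis using True by (simp add: normal_law_def)
next
  case False
  interpret N: prob_space std_normal_distribution
    by (rule prob_space_normal_density) simp
  have "distributed std_normal_distribution lborel (\<lambda>x. x) (normal_density 0 1)"
    by (simp add: distributed_def distr_id2)
  from N.normal_density_affine[OF this, of "sqrt v" 0] False assms
  have "distributed std_normal_distribution lborel (\<lambda>x. sqrt v * x) (normal_density 0 (sqrt v))"
    by simp
  then have "distr std_normal_distribution lborel (\<lambda>x. sqrt v * x)
      = density lborel (normal_density 0 (sqrt v))"
    by (simp add: distributed_def)
  moreover have "distr std_normal_distribution lborel (\<lambda>x. sqrt v * x)
      = distr std_normal_distribution borel (\<lambda>x. sqrt v * x)"
    by (rule distr_cong) auto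
  ultimately show ?thesis using False by (simp add: normal_law_def)
qed

lemma real_distribution_normal_law: "0 \<le> v \<Longrightarrow> real_distribution (normal_law 0 v)"
  using prob_space.real_distribution_distr[OF prob_space_normal_density, of 1 "\<lambda>x. sqrt v * x" 0]
  by (simp add: normal_law_eq_distr)

lemma char_distr_scale:
  assumes [measurable]: "f \<in> borel_measurable M"
  shows "char (distr M borel (\<lambda>\<xi>. c * f \<xi>)) t = char (distr M borel f) (c * t)"
  by (simp add: char_def integral_distr ac_simps)

text \<open>The limit variance of the statistic is not known to be positive, so the degenerate case
  is included: there every \<open>Y n\<close> vanishes almost surely and both sides are the point
  mass at 0. Otherwise the standardized theorem is rescaled by \<open>sqrt v\<close>.\<close>

lemma (in prob_space) central_limit_theorem_normal_law:
  fixes Y :: "nat \<Rightarrow> 'a \<Rightarrow> real"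
  assumes indep: "indep_vars (\<lambda>i. borel) Y UNIV"
    and mean: "\<And>n. expectation (Y n) = 0"
    and square: "\<And>n. integrable M (\<lambda>x. (Y n x)\<^sup>2)"
    and var: "\<And>n. expectation (\<lambda>x. (Y n x)\<^sup>2) = v"
    and ident: "\<And>n. distr M borel (Y n) = \<mu>"
  shows "weak_conv_m (\<lambda>n. distr M borel (\<lambda>x. (\<Sum>i<n. Y i x) / sqrt n)) (normal_law 0 v)"
proof -
  have Y[measurable]: "Y n \<in> borel_measurable M" for n
    using indep unfolding indep_vars_def2 by simp
  have v: "0 \<le> v" by (simp flip: var[of 0])
  show ?thesis
  proof (cases "v = 0")
    case True
    have "AE x in M. Y n x = 0" for n
      using integral_nonneg_eq_0_iff_AE[OF square, of n] var[of n] True by simp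
    then have "AE x in M. \<forall>n. Y n x = 0" by (simp add: AE_all_countable)
    then have "distr M borel (\<lambda>x. (\<Sum>i<n. Y i x) / sqrt n) = distr M borel (\<lambda>x. 0)" for n
      by (intro distr_cong_AE) auto
    then show ?thesis
      using True by (simp add: normal_law_def weak_conv_m_def weak_conv_def)
  next
    case False
    with v have "0 < v" by simp
    define S where "S = (\<lambda>n x. \<Sum>i<n. Y i x)"
    have [measurable]: "S n \<in> borel_measurable M" for n unfolding S_def by measurable
    have "weak_conv_m (\<lambda>n. distr M borel (\<lambda>x. (\<Sum>i<n. Y i x) / sqrt (n * (sqrt v)\<^sup>2)))
        std_normal_distribution"
      by (rule central_limit_theorem_zero_mean[OF indep mean _ square _ ident])
         (use \<open>0 < v\<close> mean var in auto)
    then have clt: "weak_conv_m (\<lambda>n. distr M borel (\<lambda>x. S n x / sqrt (n * v)))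
        std_normal_distribution"
      using \<open>0 < v\<close> by (simp add: S_def)
    \<comment> \<open>Scaling a variable by \<open>sqrt v\<close> evaluates its characteristic
      function at \<open>sqrt v * t\<close>, so convergence at that point suffices.\<close>
    have "weak_conv_m (\<lambda>n. distr M borel (\<lambda>x. sqrt v * (S n x / sqrt (n * v)))) (normal_law 0 v)"
    proof (rule levy_continuity)
      show "real_distribution (normal_law 0 v)" by (rule real_distribution_normal_law[OF v])
      fix t
      have "(\<lambda>n. char (distr M borel (\<lambda>x. S n x / sqrt (n * v))) (sqrt v * t))
          \<longlonglongrightarrow> char std_normal_distribution (sqrt v * t)"
        by (rule levy_continuity1[OF _ real_dist_normal_dist clt]) simp
      then show "(\<lambda>n. char (distr M borel (\<lambda>x. sqrt v * (S n x / sqrt (n * v)))) t)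
          \<longlonglongrightarrow> char (normal_law 0 v) t"
        by (subst char_distr_scale)
           (auto simp: normal_law_eq_distr[OF v] char_distr_scale distr_id2)
    qed simp
    moreover have "sqrt v * (S n x / sqrt (n * v)) = S n x / sqrt n" for n x
      using \<open>0 < v\<close> by (simp add: real_sqrt_mult)
    ultimately show ?thesis by (simp add: S_def)
  qed
qed

lemma (in prob_space) indep_vars_reindex:
  assumes "inj f" and "indep_vars N Y UNIV"
  shows "indep_vars (\<lambda>i. N (f i)) (\<lambda>i. Y (f i)) UNIV"
  unfolding indep_vars_def2 indep_sets_def
proof (intro conjI allI ballI impI)
  fix i :: 'b
  have sets: "indep_sets (\<lambda>i. {Y i -` A \<inter> space M |A. A \<in> sets (N i)}) UNIV"
    using assms(2) by (simp add: indep_vars_def2)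
  show "random_variable (N (f i)) (Y (f i))"
    using assms(2) by (simp add: indep_vars_def2)
  show "{Y (f i) -` A \<inter> space M |A. A \<in> sets (N (f i))} \<subseteq> events"
    using sets by (simp add: indep_sets_def)
  fix K :: "'b set" and A
  assume K: "K \<noteq> {}" "finite K"
    and A: "A \<in> Pi K (\<lambda>i. {Y (f i) -` A \<inter> space M |A. A \<in> sets (N (f i))})"
  define A' where "A' k = A (inv f k)" for k
  have A': "A' (f k) = A k" for k by (simp add: A'_def assms(1))
  have "prob (\<Inter>j\<in>f ` K. A' j) = (\<Prod>j\<in>f ` K. prob (A' j))"
    by (rule indep_setsD[OF sets]) (use K A in \<open>auto simp: A' Pi_iff\<close>)
  then show "prob (\<Inter>j\<in>K. A j) = (\<Prod>j\<in>K. prob (A j))"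
    using assms(1) by (simp add: A' prod.reindex[OF inj_on_subset[OF assms(1)]])
qed

section \<open>The linearization of the empirical zero-bias distribution function\<close>

lemma abs_le_one_plus_square: "\<bar>y\<bar> \<le> (1 + y\<^sup>2) / 2" for y :: real
  using sum_squares_bound[of "\<bar>y\<bar>" 1] by simp

lemma one_plus_square_le: "1 + y\<^sup>2 \<le> (1 + y\<^sup>2)\<^sup>2" for y :: real
  by (rule self_le_power) auto

lemma abs_diff3_le: "\<bar>a - b - c - d\<bar> \<le> \<bar>a\<bar> + \<bar>b\<bar> + \<bar>c\<bar> + \<bar>d\<bar>" for a b c d :: real
  by linarith

section \<open>Kernels whose means give the zero-bias distribution function, its density and the
  influence function\<close>

definition zb_kernel :: "real \<Rightarrow> real \<Rightarrow> real" where
  "zb_kernel t y = y * (y - t) * indicator {..t} y"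

text \<open>This is min(y - t, 0). It appears when observations are centred at the sample mean m,
  since (y - m)(y - u) = y (y - u) - m (y - u).\<close>

definition tail_kernel :: "real \<Rightarrow> real \<Rightarrow> real" where
  "tail_kernel t y = (y - t) * indicator {..t} y"

text \<open>The derivative of \<open>zb_kernel t y\<close> in t, away from t = y. For centred
  \<open>X\<close> its expectation is the zero-bias density.\<close>

definition density_kernel :: "real \<Rightarrow> real \<Rightarrow> real" where
  "density_kernel t y = - (y * indicator {..t} y)"

text \<open>\<open>C2\<close> as a function of the observed value instead of the sample point, so
  that it can be evaluated at every \<open>Xs j\<close>.\<close>

definition influence2 :: "'a measure \<Rightarrow> ('a \<Rightarrow> real) \<Rightarrow> real \<Rightarrow> real \<Rightarrow> real" where
  "influence2 M X s y = zb_kernel s y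
     - y * prob_space.expectation M (\<lambda>\<eta>. tail_kernel s (X \<eta>))
     - y\<^sup>2 * zb_cdf M X s - (1/2 * (1 - y\<^sup>2) * s - y) * zb_density M X s"

lemma C2_eq_influence2: "C2 M X s \<xi> = influence2 M X s (X \<xi>)"
  by (simp add: C2_def influence2_def zb_kernel_def tail_kernel_def)

lemma zb_kernel_bounds_nonpos:
  assumes "t \<le> 0" shows "0 \<le> zb_kernel t y" "zb_kernel t y \<le> y\<^sup>2"
proof -
  have "0 \<le> y * (y - t)" "y * (y - t) \<le> y\<^sup>2" if "y \<le> t"
    using assms that mult_nonpos_nonpos[of y "y - t"] mult_nonpos_nonpos[of y t]
    by (auto simp: power2_eq_square right_diff_distrib)
  then show "0 \<le> zb_kernel t y" "zb_kernel t y \<le> y\<^sup>2"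
    by (auto simp: zb_kernel_def indicator_def)
qed

text \<open>For t > 0 the kernel is negative on 0 < y < t, so a bound by 0 from below fails
  pointwise. Both bounds are therefore shifted by - t y, which averages to zero for centred data.
  Means of the kernel then lie between 0 and the second moment.\<close>

lemma zb_kernel_bounds_nonneg:
  assumes "0 \<le> t" shows "- (t * y) \<le> zb_kernel t y" "zb_kernel t y \<le> y\<^sup>2 - t * y"
proof -
  have "t * y \<le> y * y" if "t \<le> y"
    using assms that by (intro mult_right_mono) auto
  then show "- (t * y) \<le> zb_kernel t y" "zb_kernel t y \<le> y\<^sup>2 - t * y"
    using assms by (auto simp: zb_kernel_def indicator_def power2_eq_square algebra_simps)
qed

text \<open>First-order expansion in the threshold. It is exact unless y lies between t and u; there
  the error is y times the distance from y to u, and y is within \<eta> of t.\<close>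

lemma zb_kernel_increment:
  assumes "\<bar>u - t\<bar> \<le> \<eta>"
  shows "\<bar>zb_kernel u y - zb_kernel t y - (u - t) * density_kernel t y\<bar>
    \<le> \<eta> * (\<bar>y\<bar> * indicator {t - \<eta>..t + \<eta>} y)"
proof -
  consider "y \<le> u" "y \<le> t" | "u < y" "t < y" | "u < y" "y \<le> t" | "t < y" "y \<le> u" by linarith
  then show ?thesis
  proof cases
    case 3
    then have "zb_kernel u y - zb_kernel t y - (u - t) * density_kernel t y = y * (u - y)"
      by (simp add: zb_kernel_def density_kernel_def algebra_simps)
    moreover have "\<bar>y * (u - y)\<bar> \<le> \<bar>y\<bar> * \<eta>"
      unfolding abs_mult using 3 assms by (intro mult_left_mono) auto
    ultimately show ?thesis using 3 assms by (simp add: mult.commute)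
  next
    case 4
    then have "zb_kernel u y - zb_kernel t y - (u - t) * density_kernel t y = y * (y - u)"
      by (simp add: zb_kernel_def density_kernel_def algebra_simps)
    moreover have "\<bar>y * (y - u)\<bar> \<le> \<bar>y\<bar> * \<eta>"
      unfolding abs_mult using 4 assms by (intro mult_left_mono) auto
    ultimately show ?thesis using 4 assms by (simp add: mult.commute)
  qed (use assms in \<open>simp_all add: zb_kernel_def density_kernel_def algebra_simps\<close>)
qed

lemma tail_kernel_Lipschitz: "\<bar>tail_kernel u y - tail_kernel t y\<bar> \<le> \<bar>u - t\<bar>"
  by (auto simp: tail_kernel_def indicator_def)

lemma abs_density_kernel_le: "\<bar>density_kernel t y\<bar> \<le> \<bar>y\<bar>"
  by (simp add: density_kernel_def indicator_def)

lemma density_kernel_square_le: "(density_kernel t y)\<^sup>2 \<le> y\<^sup>2"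
  using abs_density_kernel_le by (simp add: abs_le_square_iff)

lemma tail_kernel_square_le: "(tail_kernel t y)\<^sup>2 \<le> (y - t)\<^sup>2"
  by (simp add: tail_kernel_def indicator_def)

lemma abs_tail_kernel_le: "\<bar>tail_kernel t y\<bar> \<le> \<bar>y\<bar> + \<bar>t\<bar>"
  by (auto simp: tail_kernel_def indicator_def)

text \<open>The threshold varies with the argument, so the indicator is treated through the
  inequality between \<open>g x\<close> and \<open>f x\<close> and not as that of a fixed
  set.\<close>

lemma measurable_zb_kernel[measurable (raw)]:
  assumes [measurable]: "f \<in> borel_measurable M" "g \<in> borel_measurable M"
  shows "(\<lambda>x. zb_kernel (f x) (g x)) \<in> borel_measurable M"
  unfolding zb_kernel_def by (measurable, unfold atMost_iff, measurable)

lemma measurable_tail_kernel[measurable (raw)]: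
  assumes [measurable]: "f \<in> borel_measurable M" "g \<in> borel_measurable M"
  shows "(\<lambda>x. tail_kernel (f x) (g x)) \<in> borel_measurable M"
  unfolding tail_kernel_def by (measurable, unfold atMost_iff, measurable)

lemma measurable_density_kernel[measurable (raw)]:
  assumes [measurable]: "f \<in> borel_measurable M" "g \<in> borel_measurable M"
  shows "(\<lambda>x. density_kernel (f x) (g x)) \<in> borel_measurable M"
  unfolding density_kernel_def by (measurable, unfold atMost_iff, measurable)

section \<open>Algebra of sample means\<close>

lemma sample_mean_add: "sample_mean n (\<lambda>j. f j + g j) = sample_mean n f + sample_mean n g"
  by (simp add: sample_mean_def sum.distrib add_divide_distrib)

lemma sample_mean_diff: "sample_mean n (\<lambda>j. f j - g j) = sample_mean n f - sample_mean n g"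
  by (simp add: sample_mean_def sum_subtractf diff_divide_distrib)

lemma sample_mean_cmult: "sample_mean n (\<lambda>j. c * f j) = c * sample_mean n f"
  by (simp add: sample_mean_def flip: sum_distrib_left)

lemma sample_mean_multc: "sample_mean n (\<lambda>j. f j * c) = sample_mean n f * c"
  by (simp add: sample_mean_def flip: sum_distrib_right)

lemma sample_mean_const: "0 < n \<Longrightarrow> sample_mean n (\<lambda>j. c) = c"
  by (simp add: sample_mean_def)

lemma sample_mean_mono: "(\<And>j. f j \<le> g j) \<Longrightarrow> sample_mean n f \<le> sample_mean n g"
  by (auto simp: sample_mean_def intro!: divide_right_mono sum_mono)

lemma sample_mean_abs_le:
  assumes "\<And>j. \<bar>f j\<bar> \<le> g j" shows "\<bar>sample_mean n f\<bar> \<le> sample_mean n g"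
proof -
  have "sample_mean n f \<le> sample_mean n g" "sample_mean n (\<lambda>j. -1 * f j) \<le> sample_mean n g"
    using assms by (intro sample_mean_mono; simp add: abs_le_iff)+
  then show ?thesis unfolding sample_mean_cmult by simp
qed

lemmas sample_mean_linear = sample_mean_add sample_mean_diff sample_mean_cmult sample_mean_multc

lemma sample_var_eq:
  assumes "0 < n"
  shows "sample_var n x = sample_mean n (\<lambda>j. (x j)\<^sup>2) - (sample_mean n x)\<^sup>2"
proof -
  let ?m = "sample_mean n x"
  have "sample_var n x = sample_mean n (\<lambda>j. (x j)\<^sup>2 - (2 * ?m) * x j + ?m\<^sup>2)"
    unfolding sample_var_def power2_diff by (subst sample_mean_def) (simp add: algebra_simps)
  then show ?thesis
    using assms by (simp add: sample_mean_linear sample_mean_const power2_eq_square)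
qed

section \<open>The empirical zero-bias distribution function of the scaled residuals\<close>

definition emp_zb_cdf :: "nat \<Rightarrow> (nat \<Rightarrow> real) \<Rightarrow> real \<Rightarrow> real" where
  "emp_zb_cdf n x t = sample_mean n (\<lambda>j. zb_kernel t (scaled_residual n x j))"

lemma sample_mean_zb_kernel_bounds:
  assumes "0 < n" "sample_mean n y = 0" "sample_mean n (\<lambda>j. (y j)\<^sup>2) = 1"
  shows "0 \<le> sample_mean n (\<lambda>j. zb_kernel t (y j))" "sample_mean n (\<lambda>j. zb_kernel t (y j)) \<le> 1"
proof -
  have "0 \<le> sample_mean n (\<lambda>j. zb_kernel t (y j)) \<and> sample_mean n (\<lambda>j. zb_kernel t (y j)) \<le> 1"
  proof (cases "t \<le> 0")
    case True
    from sample_mean_mono[OF zb_kernel_bounds_nonpos(1)[OF True], of n y]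
         sample_mean_mono[OF zb_kernel_bounds_nonpos(2)[OF True], of n y]
    show ?thesis using assms by (simp add: sample_mean_const)
  next
    case False
    then have t: "0 \<le> t" by simp
    have "sample_mean n (\<lambda>j. (- t) * y j) \<le> sample_mean n (\<lambda>j. zb_kernel t (y j))"
      using zb_kernel_bounds_nonneg(1)[OF t] by (intro sample_mean_mono) simp
    moreover have "sample_mean n (\<lambda>j. zb_kernel t (y j)) \<le> sample_mean n (\<lambda>j. (y j)\<^sup>2 - t * y j)"
      using zb_kernel_bounds_nonneg(2)[OF t] by (intro sample_mean_mono) simp
    ultimately show ?thesis using assms unfolding sample_mean_linear by simp
  qed
  then show "0 \<le> sample_mean n (\<lambda>j. zb_kernel t (y j))" "sample_mean n (\<lambda>j. zb_kernel t (y j)) \<le> 1"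
    by auto
qed

lemma emp_zb_cdf_bounds:
  assumes n: "0 < n" and var: "0 < sample_var n x"
  shows "0 \<le> emp_zb_cdf n x t" "emp_zb_cdf n x t \<le> 1"
proof -
  have *: "sample_mean n (scaled_residual n x) = 0"
    using n by (simp add: scaled_residual_def[abs_def] divide_inverse sample_mean_linear sample_mean_const)
  have "(scaled_residual n x j)\<^sup>2 = (x j - sample_mean n x)\<^sup>2 * inverse (sample_var n x)" for j
    using var by (simp add: scaled_residual_def power_divide) (simp add: divide_inverse)
  moreover have "sample_mean n (\<lambda>j. (x j - sample_mean n x)\<^sup>2) = sample_var n x"
    by (simp add: sample_mean_def sample_var_def)
  ultimately have "sample_mean n (\<lambda>j. (scaled_residual n x j)\<^sup>2) = 1"
    using var by (simp add: sample_mean_multc)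
  with * n show "0 \<le> emp_zb_cdf n x t" "emp_zb_cdf n x t \<le> 1"
    unfolding emp_zb_cdf_def by (auto intro: sample_mean_zb_kernel_bounds)
qed

text \<open>A residual is at most t exactly when the observation is at most u. Multiplying by the
  sample variance clears both denominators, leaving means over the raw observations with only m and
  u depending on the sample as a whole.\<close>

lemma sample_var_times_emp_zb_cdf:
  fixes x n t
  defines "m \<equiv> sample_mean n x" and "u \<equiv> sample_mean n x + sqrt (sample_var n x) * t"
  assumes var: "0 < sample_var n x"
  shows "sample_var n x * emp_zb_cdf n x t
     = sample_mean n (\<lambda>j. zb_kernel u (x j)) - m * sample_mean n (\<lambda>j. tail_kernel u (x j))"
proof -
  define S where "S = sqrt (sample_var n x)"
  have S: "0 < S" "S\<^sup>2 = sample_var n x" using var by (auto simp: S_def)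
  have "S\<^sup>2 * zb_kernel t (scaled_residual n x j) = zb_kernel u (x j) - m * tail_kernel u (x j)" for j
  proof -
    have "scaled_residual n x j \<le> t \<longleftrightarrow> x j \<le> u"
      using S(1) by (simp add: scaled_residual_def u_def S_def[symmetric] pos_divide_le_eq algebra_simps)
    moreover have "S\<^sup>2 * (scaled_residual n x j * (scaled_residual n x j - t)) = (x j - m) * (x j - u)"
      using S(1) by (simp add: scaled_residual_def u_def m_def S_def[symmetric] field_simps power2_eq_square)
    ultimately show ?thesis
      by (auto simp: zb_kernel_def tail_kernel_def indicator_def algebra_simps)
  qed
  then show ?thesis
    by (simp add: emp_zb_cdf_def S(2)[symmetric] sample_mean_linear flip: sample_mean_cmult)
qed

section \<open>Deterministic linearization with a second-order remainder\<close>

lemma abs_diff_one_le_square: "\<bar>s - 1\<bar> \<le> \<bar>s\<^sup>2 - 1\<bar>" if "0 \<le> s" for s :: real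
proof -
  have "\<bar>s - 1\<bar> * 1 \<le> \<bar>s - 1\<bar> * (s + 1)" using that by (intro mult_left_mono) auto
  also have "\<dots> = \<bar>(s - 1) * (s + 1)\<bar>" using that by (simp add: abs_mult)
  also have "(s - 1) * (s + 1) = s\<^sup>2 - 1" by (simp add: power2_eq_square algebra_simps)
  finally show ?thesis by simp
qed

text \<open>The analytic content, freed from the sample. Here m is the sample mean, q the second
  sample moment minus 1, S the standard deviation and u the random threshold. \<open>A\<close>,
  \<open>Kt\<close>, \<open>e\<close> are sample means of the three kernels at t, and
  \<open>Au\<close>, \<open>Ku\<close> those at u. \<open>H\<close>, \<open>K\<close>,
  \<open>d\<close> are the population values, \<open>F\<close> is the empirical function,
  \<open>L\<close> the mean influence, and \<open>N\<close> the mean of |x| over observations near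
  t. First S^2 (F - H) - L is bounded by \<open>E\<close>, then the factor S^2 is removed.\<close>

lemma linearization_core:
  fixes t :: real
  assumes S: "0 < S" "S\<^sup>2 = 1 + q - m\<^sup>2" and m: "\<bar>m\<bar> \<le> \<delta>" and q: "\<bar>q\<bar> \<le> \<delta>" and \<delta>: "\<delta> \<le> 1/4"
    and eta: "\<eta> = 2 * \<delta> * (1 + \<bar>t\<bar>)" and u: "\<bar>u - t\<bar> \<le> \<eta>" "u = m + S * t"
    and A: "\<bar>Au - A - (u - t) * e\<bar> \<le> \<eta> * N" and Ku: "\<bar>Ku - Kt\<bar> \<le> \<eta>"
    and d: "\<bar>d\<bar> \<le> 1" and H: "0 \<le> H" "H \<le> 1" and F: "0 \<le> F" "F \<le> 1" "S\<^sup>2 * F = Au - m * Ku"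
    and L: "L = A - H - m * K - q * H + (q * t / 2 + m) * d"
    and E: "E = \<eta> * N + \<eta>\<^sup>2 / 2 + (e - d)\<^sup>2 / 2 + 3 * \<delta>\<^sup>2 * \<bar>t\<bar> + \<delta>\<^sup>2 / 2 + (Kt - K)\<^sup>2 / 2 + \<delta> * \<eta> + \<delta>\<^sup>2"
  shows "2 * \<bar>F - H - L\<bar> + (F - H)\<^sup>2 \<le> 14 * E + 2 * \<delta>\<^sup>2 + 12 * L\<^sup>2"
proof -
  have \<delta>0: "0 \<le> \<delta>" and \<eta>0: "0 \<le> \<eta>" using m u(1) by auto
  have m2: "m\<^sup>2 \<le> \<delta>\<^sup>2" using m by (simp add: abs_le_square_iff[symmetric] \<delta>0)
  have \<delta>2: "\<delta>\<^sup>2 \<le> \<delta> / 4" using mult_left_mono[OF \<delta> \<delta>0] by (simp add: power2_eq_square)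
  have S2: "\<bar>S\<^sup>2 - 1\<bar> \<le> 2 * \<delta>" using S(2) m2 \<delta>2 \<delta>0 q zero_le_power2[of m] unfolding abs_le_iff by linarith
  have S1: "\<bar>S - 1\<bar> \<le> 2 * \<delta>" using abs_diff_one_le_square[of S] S(1) S2 by simp
  have S12: "(S - 1)\<^sup>2 \<le> 4 * \<delta>\<^sup>2"
    using power_mono[OF S1, of 2] by (simp add: power_mult_distrib)
  have "S\<^sup>2 * (F - H) - L = (Au - A - (u - t) * e) + (u - t) * (e - d) + m * (K - Kt)
      + m * (Kt - Ku) + m\<^sup>2 * H + d * t * (S - 1 - q / 2)"
    unfolding right_diff_distrib F(3) unfolding S(2) L u(2) by (simp add: algebra_simps)
  \<comment> \<open>The linearization S - 1 ~ q / 2 of the square root, with its exact quadratic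
    error. This is where the coefficient q t / 2 of d in \<open>L\<close> comes from.\<close>
  moreover have "S - 1 - q / 2 = - ((S - 1)\<^sup>2 + m\<^sup>2) / 2"
    using S(2) by (simp add: power2_eq_square algebra_simps)
  ultimately have split: "S\<^sup>2 * (F - H) - L = (Au - A - (u - t) * e) + (u - t) * (e - d) + m * (K - Kt)
      + m * (Kt - Ku) + m\<^sup>2 * H + d * t * (- ((S - 1)\<^sup>2 + m\<^sup>2) / 2)" by simp
  \<comment> \<open>Products of two small quantities are separated into squares, so that the random
    deviations can later be averaged one by one.\<close>
  have amgm: "\<bar>a * b\<bar> \<le> c\<^sup>2 / 2 + b\<^sup>2 / 2" if "\<bar>a\<bar> \<le> c" for a b c :: real
  proof -
    have "\<bar>a * b\<bar> \<le> c * \<bar>b\<bar>" unfolding abs_mult using that by (intro mult_right_mono) auto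
    also have "\<dots> \<le> c\<^sup>2 / 2 + b\<^sup>2 / 2"
      using sum_squares_bound[of c "\<bar>b\<bar>"] by simp
    finally show ?thesis .
  qed
  have b1: "\<bar>(u - t) * (e - d)\<bar> \<le> \<eta>\<^sup>2 / 2 + (e - d)\<^sup>2 / 2" by (rule amgm[OF u(1)])
  have b2: "\<bar>m * (K - Kt)\<bar> \<le> \<delta>\<^sup>2 / 2 + (Kt - K)\<^sup>2 / 2"
    using amgm[OF m, of "K - Kt"] by (simp add: power2_commute)
  have b3: "\<bar>m * (Kt - Ku)\<bar> \<le> \<delta> * \<eta>"
    unfolding abs_mult using m Ku \<delta>0 by (intro mult_mono) auto
  have b4: "\<bar>m\<^sup>2 * H\<bar> \<le> \<delta>\<^sup>2"
    using mult_mono[OF m2 H(2)] H(1) by (simp add: abs_mult)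
  have half: "((S - 1)\<^sup>2 + m\<^sup>2) / 2 \<le> 3 * \<delta>\<^sup>2"
  proof -
    have "((S - 1)\<^sup>2 + m\<^sup>2) / 2 \<le> (4 * \<delta>\<^sup>2 + \<delta>\<^sup>2) / 2"
      by (intro divide_right_mono add_mono S12 m2) simp
    also have "\<dots> \<le> 3 * \<delta>\<^sup>2" by simp
    finally show ?thesis .
  qed
  have b5: "\<bar>d * t * (- ((S - 1)\<^sup>2 + m\<^sup>2) / 2)\<bar> \<le> 3 * \<delta>\<^sup>2 * \<bar>t\<bar>"
  proof -
    have "\<bar>d * t * (- ((S - 1)\<^sup>2 + m\<^sup>2) / 2)\<bar> = \<bar>d\<bar> * (\<bar>t\<bar> * (((S - 1)\<^sup>2 + m\<^sup>2) / 2))"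
      by (simp add: abs_mult)
    also have "\<dots> \<le> 1 * (\<bar>t\<bar> * (3 * \<delta>\<^sup>2))"
      using half d by (intro mult_mono mult_left_mono) auto
    finally show ?thesis by (simp add: ac_simps)
  qed
  have rem: "\<bar>S\<^sup>2 * (F - H) - L\<bar> \<le> E"
    unfolding split E using A b1 b2 b3 b4 b5 by linarith
  have FH: "\<bar>F - H\<bar> \<le> 1" using F H by auto
  \<comment> \<open>Since S^2 is at least 1/2, |F - H| is at most 2 |L| + 2 E. Multiplying by |F -
    H| and absorbing half of (F - H)^2 handles the first summand; in the second, |F - H| <= 1 keeps
    \<open>E\<close> linear.\<close>
  have sq: "(F - H)\<^sup>2 \<le> 4 * L\<^sup>2 + 4 * E"
  proof -
    have "1/2 \<le> S\<^sup>2" using S2 \<delta> by (auto simp: abs_le_iff)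
    then have "1/2 * \<bar>F - H\<bar> \<le> S\<^sup>2 * \<bar>F - H\<bar>" by (intro mult_right_mono) auto
    also have "\<dots> = \<bar>S\<^sup>2 * (F - H)\<bar>" by (simp add: abs_mult)
    also have "\<dots> \<le> \<bar>L\<bar> + E" using rem by linarith
    finally have "\<bar>F - H\<bar> \<le> 2 * \<bar>L\<bar> + 2 * E" by simp
    then have "\<bar>F - H\<bar> * \<bar>F - H\<bar> \<le> \<bar>F - H\<bar> * (2 * \<bar>L\<bar> + 2 * E)" by (intro mult_left_mono) auto
    also have "\<dots> = (2 * \<bar>L\<bar>) * \<bar>F - H\<bar> + \<bar>F - H\<bar> * (2 * E)" by (simp add: algebra_simps)
    also have "(2 * \<bar>L\<bar>) * \<bar>F - H\<bar> \<le> (2 * \<bar>L\<bar>)\<^sup>2 / 2 + (F - H)\<^sup>2 / 2"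
      using sum_squares_bound[of "2 * \<bar>L\<bar>" "\<bar>F - H\<bar>"] by simp
    also have "\<bar>F - H\<bar> * (2 * E) \<le> 1 * (2 * E)"
      using FH rem by (intro mult_right_mono) auto
    finally show ?thesis by (simp add: power2_eq_square)
  qed
  \<comment> \<open>Dropping the factor S^2 costs a product of two small terms, which is again split
    into squares.\<close>
  have eq: "F - H - L = (S\<^sup>2 * (F - H) - L) - (S\<^sup>2 - 1) * (F - H)" by (simp add: algebra_simps)
  have "\<bar>F - H - L\<bar> \<le> E + \<bar>(S\<^sup>2 - 1) * (F - H)\<bar>"
    unfolding eq by (rule order_trans[OF abs_triangle_ineq4 add_mono[OF rem order_refl]])
  also have "\<bar>(S\<^sup>2 - 1) * (F - H)\<bar> \<le> 2 * \<delta> * \<bar>F - H\<bar>"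
    unfolding abs_mult using S2 by (intro mult_right_mono) auto
  also have "\<dots> \<le> \<delta>\<^sup>2 + (F - H)\<^sup>2"
    using sum_squares_bound[of \<delta> "\<bar>F - H\<bar>"] by simp
  finally have "\<bar>F - H - L\<bar> \<le> E + (\<delta>\<^sup>2 + (F - H)\<^sup>2)" by simp
  \<comment> \<open>Here 2 a + b <= 2 E + 2 c + 3 b, and 3 b <= 12 l + 12 E.\<close>
  moreover have "2 * a + b \<le> 14 * E + 2 * c + 12 * l" if "b \<le> 4 * l + 4 * E" "a \<le> E + (c + b)"
    for a b c l :: real using that by linarith
  ultimately show ?thesis using sq by blast
qed

text \<open>The bound \<open>14 E + 2 \<delta>\<^sup>2 + 12 L\<^sup>2\<close> of \<open>linearization_core\<close> with \<open>\<eta>\<close> and \<open>E\<close> written out.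
  Deviations of sample means enter through their squares only, so that independence gives the
  expectation.\<close>

definition lin_bound :: "'a measure \<Rightarrow> ('a \<Rightarrow> real) \<Rightarrow> nat \<Rightarrow> (nat \<Rightarrow> real) \<Rightarrow> real \<Rightarrow> real \<Rightarrow> real" where
  "lin_bound M X n x \<delta> t =
     14 * (2 * \<delta> * (1 + \<bar>t\<bar>) * sample_mean n (\<lambda>j. \<bar>x j\<bar> *
              indicator {t - 2 * \<delta> * (1 + \<bar>t\<bar>)..t + 2 * \<delta> * (1 + \<bar>t\<bar>)} (x j))
           + (2 * \<delta> * (1 + \<bar>t\<bar>))\<^sup>2 / 2
           + (sample_mean n (\<lambda>j. density_kernel t (x j)) - zb_density M X t)\<^sup>2 / 2
           + 3 * \<delta>\<^sup>2 * \<bar>t\<bar> + \<delta>\<^sup>2 / 2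
           + (sample_mean n (\<lambda>j. tail_kernel t (x j))
                - prob_space.expectation M (\<lambda>\<xi>. tail_kernel t (X \<xi>)))\<^sup>2 / 2
           + \<delta> * (2 * \<delta> * (1 + \<bar>t\<bar>)) + \<delta>\<^sup>2)
     + 2 * \<delta>\<^sup>2 + 12 * (sample_mean n (\<lambda>j. influence2 M X t (x j)))\<^sup>2"

text \<open>No probability enters: the estimate holds for every sample whose first two moments are
  within \<delta> of 0 and 1. Then the sample variance is within 2 \<delta> <= 1/2 of 1, hence
  positive, and the residuals are genuinely standardized.\<close>

lemma linearization:
  fixes x n t
  assumes n: "0 < n" and \<delta>: "\<delta> \<le> 1/4"
    and m: "\<bar>sample_mean n x\<bar> \<le> \<delta>" and q: "\<bar>sample_mean n (\<lambda>j. (x j)\<^sup>2) - 1\<bar> \<le> \<delta>"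
    and d: "\<bar>zb_density M X t\<bar> \<le> 1" and H: "0 \<le> zb_cdf M X t" "zb_cdf M X t \<le> 1"
  shows "0 < sample_var n x"
    and "2 * \<bar>emp_zb_cdf n x t - zb_cdf M X t - sample_mean n (\<lambda>j. influence2 M X t (x j))\<bar>
      + (emp_zb_cdf n x t - zb_cdf M X t)\<^sup>2 \<le> lin_bound M X n x \<delta> t"
proof -
  define m' q' where "m' = sample_mean n x" and "q' = sample_mean n (\<lambda>j. (x j)\<^sup>2) - 1"
  have \<delta>0: "0 \<le> \<delta>" using m by simp
  have var: "sample_var n x = 1 + q' - m'\<^sup>2"
    using sample_var_eq[OF n] by (simp add: m'_def q'_def)
  have m2: "m'\<^sup>2 \<le> \<delta>\<^sup>2" using m by (simp add: abs_le_square_iff[symmetric] \<delta>0 m'_def)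
  have \<delta>2: "\<delta>\<^sup>2 \<le> \<delta> / 4" using mult_left_mono[OF \<delta> \<delta>0] by (simp add: power2_eq_square)
  have S2: "\<bar>sample_var n x - 1\<bar> \<le> 2 * \<delta>"
    using var m2 \<delta>2 \<delta>0 q zero_le_power2[of m'] unfolding abs_le_iff q'_def by linarith
  show pos: "0 < sample_var n x" using S2 \<delta> by (auto simp: abs_le_iff)
  define S where "S = sqrt (sample_var n x)"
  have S: "0 < S" "S\<^sup>2 = 1 + q' - m'\<^sup>2" using pos var by (auto simp: S_def)
  define u where "u = m' + S * t"
  \<comment> \<open>The threshold moves by m + (S - 1) t, with |m| <= \<delta> and |S - 1| <= 2
    \<delta>.\<close>
  define \<eta> where "\<eta> = 2 * \<delta> * (1 + \<bar>t\<bar>)"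
  have u: "\<bar>u - t\<bar> \<le> \<eta>"
  proof -
    have "\<bar>S - 1\<bar> \<le> 2 * \<delta>" using abs_diff_one_le_square[of S] S S2 var by simp
    then have "\<bar>(S - 1) * t\<bar> \<le> 2 * \<delta> * \<bar>t\<bar>" unfolding abs_mult by (intro mult_right_mono) auto
    moreover have "u - t = m' + (S - 1) * t" by (simp add: u_def algebra_simps)
    ultimately show ?thesis
      using m \<delta>0 by (simp add: \<eta>_def m'_def algebra_simps abs_le_iff)
  qed
  have F: "S\<^sup>2 * emp_zb_cdf n x t
     = sample_mean n (\<lambda>j. zb_kernel u (x j)) - m' * sample_mean n (\<lambda>j. tail_kernel u (x j))"
    using sample_var_times_emp_zb_cdf[OF pos] S var by (simp add: u_def S_def m'_def)
  have A: "\<bar>sample_mean n (\<lambda>j. zb_kernel u (x j)) - sample_mean n (\<lambda>j. zb_kernel t (x j))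
      - (u - t) * sample_mean n (\<lambda>j. density_kernel t (x j))\<bar>
      \<le> \<eta> * sample_mean n (\<lambda>j. \<bar>x j\<bar> * indicator {t - \<eta>..t + \<eta>} (x j))"
    using sample_mean_abs_le[OF zb_kernel_increment[OF u], of n x] by (simp add: sample_mean_linear)
  have K: "\<bar>sample_mean n (\<lambda>j. tail_kernel u (x j)) - sample_mean n (\<lambda>j. tail_kernel t (x j))\<bar> \<le> \<eta>"
    using sample_mean_abs_le[of "\<lambda>j. tail_kernel u (x j) - tail_kernel t (x j)" "\<lambda>j. \<bar>u - t\<bar>" n]
      tail_kernel_Lipschitz u n
    by (simp add: sample_mean_linear sample_mean_const)
  have L: "sample_mean n (\<lambda>j. influence2 M X t (x j))
     = sample_mean n (\<lambda>j. zb_kernel t (x j)) - zb_cdf M X t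
       - m' * prob_space.expectation M (\<lambda>\<xi>. tail_kernel t (X \<xi>)) - q' * zb_cdf M X t
       + (q' * t / 2 + m') * zb_density M X t"
  proof -
    \<comment> \<open>Written as the kernel plus a quadratic polynomial in y, the influence function
      can be averaged term by term.\<close>
    have "influence2 M X t y = zb_kernel t y - y * prob_space.expectation M (\<lambda>\<xi>. tail_kernel t (X \<xi>))
        - y\<^sup>2 * zb_cdf M X t - c + y\<^sup>2 * c + y * zb_density M X t"
      if "c = t * zb_density M X t / 2" for y c
      unfolding influence2_def that by (simp add: algebra_simps)
    note eq = this[OF refl]
    show ?thesis
      using n unfolding eq sample_mean_linear
      by (simp add: sample_mean_const m'_def q'_def) (simp add: field_simps)
  qed
  show "2 * \<bar>emp_zb_cdf n x t - zb_cdf M X t - sample_mean n (\<lambda>j. influence2 M X t (x j))\<bar>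
      + (emp_zb_cdf n x t - zb_cdf M X t)\<^sup>2 \<le> lin_bound M X n x \<delta> t"
    unfolding lin_bound_def
    by (rule linearization_core[OF S _ _ \<delta> \<eta>_def u u_def A K d H
          emp_zb_cdf_bounds[OF n pos] F L])
       (use m q in \<open>simp_all add: m'_def q'_def \<eta>_def\<close>)
qed

lemma measurable_sample_mean[measurable (raw)]:
  assumes [measurable]: "\<And>j. f j \<in> borel_measurable M"
  shows "(\<lambda>x. sample_mean n (\<lambda>j. f j x)) \<in> borel_measurable M"
  unfolding sample_mean_def by measurable

lemma measurable_sample_var[measurable (raw)]:
  assumes [measurable]: "\<And>j. f j \<in> borel_measurable M"
  shows "(\<lambda>x. sample_var n (\<lambda>j. f j x)) \<in> borel_measurable M"
  unfolding sample_var_def by measurable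

lemma measurable_emp_zb_cdf[measurable (raw)]:
  assumes [measurable]: "\<And>j. f j \<in> borel_measurable M" "g \<in> borel_measurable M"
  shows "(\<lambda>x. emp_zb_cdf n (\<lambda>j. f j x) (g x)) \<in> borel_measurable M"
  unfolding emp_zb_cdf_def scaled_residual_def by measurable

section \<open>Moment bounds for i.i.d. samples\<close>

locale iid_sample = prob_space M for M :: "'a measure" +
  fixes X :: "'a \<Rightarrow> real" and Xs :: "nat \<Rightarrow> 'a \<Rightarrow> real"
  assumes rv[measurable]: "X \<in> borel_measurable M"
    and indep: "indep_vars (\<lambda>_. borel) Xs UNIV"
    and ident: "\<And>k. distr M borel (Xs k) = distr M borel X"
begin

lemma rv_Xs[measurable]: "Xs k \<in> borel_measurable M"
  using indep unfolding indep_vars_def2 by simp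

lemma expectation_Xs:
  fixes f :: "real \<Rightarrow> real"
  assumes [measurable]: "f \<in> borel_measurable borel"
  shows "expectation (\<lambda>\<xi>. f (Xs k \<xi>)) = expectation (\<lambda>\<xi>. f (X \<xi>))"
  using integral_distr[of "Xs k" M borel f] integral_distr[of X M borel f] by (simp add: ident)

lemma integrable_Xs_iff:
  fixes f :: "real \<Rightarrow> real"
  assumes [measurable]: "f \<in> borel_measurable borel"
  shows "integrable M (\<lambda>\<xi>. f (Xs k \<xi>)) \<longleftrightarrow> integrable M (\<lambda>\<xi>. f (X \<xi>))"
  using integrable_distr_eq[of "Xs k" M borel f] integrable_distr_eq[of X M borel f] by (simp add: ident)

lemma
  fixes f :: "real \<Rightarrow> real"
  assumes n: "0 < n" and [measurable]: "f \<in> borel_measurable borel"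
    and int: "integrable M (\<lambda>\<xi>. f (X \<xi>))"
  shows integrable_sample_mean: "integrable M (\<lambda>\<xi>. sample_mean n (\<lambda>j. f (Xs j \<xi>)))"
    and expectation_sample_mean:
      "expectation (\<lambda>\<xi>. sample_mean n (\<lambda>j. f (Xs j \<xi>))) = expectation (\<lambda>\<xi>. f (X \<xi>))"
  using int n by (simp_all add: sample_mean_def integrable_Xs_iff expectation_Xs)

text \<open>Expanding the square gives n^2 products. Independence and centring remove the mixed
  ones, and the n diagonal terms have a common expectation.\<close>

lemma
  fixes f :: "real \<Rightarrow> real"
  assumes n: "0 < n" and f[measurable]: "f \<in> borel_measurable borel"
    and sq: "integrable M (\<lambda>\<xi>. (f (X \<xi>))\<^sup>2)" and mean: "expectation (\<lambda>\<xi>. f (X \<xi>)) = 0"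
  shows integrable_sample_mean_square: "integrable M (\<lambda>\<xi>. (sample_mean n (\<lambda>j. f (Xs j \<xi>)))\<^sup>2)"
    and expectation_sample_mean_square:
      "expectation (\<lambda>\<xi>. (sample_mean n (\<lambda>j. f (Xs j \<xi>)))\<^sup>2) = expectation (\<lambda>\<xi>. (f (X \<xi>))\<^sup>2) / n"
proof -
  define g where "g j \<xi> = f (Xs j \<xi>)" for j \<xi>
  have [measurable]: "g j \<in> borel_measurable M" for j unfolding g_def by measurable
  have sqg: "integrable M (\<lambda>\<xi>. (g j \<xi>)\<^sup>2)" for j
    using sq integrable_Xs_iff[of "\<lambda>y. (f y)\<^sup>2" j] by (simp add: g_def)
  have intg: "integrable M (g j)" for j
    by (rule square_integrable_imp_integrable[OF _ sqg]) simp
  have indep_g: "indep_vars (\<lambda>_. borel) g UNIV"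
    unfolding g_def[abs_def] by (rule indep_vars_compose2[OF indep]) simp
  have mean_g: "expectation (g j) = 0" for j
    using mean expectation_Xs[of f j] by (simp add: g_def[abs_def])
  have prod: "integrable M (\<lambda>\<xi>. g i \<xi> * g j \<xi>)"
    "expectation (\<lambda>\<xi>. g i \<xi> * g j \<xi>) = (if i = j then expectation (\<lambda>\<xi>. (f (X \<xi>))\<^sup>2) else 0)" for i j
  proof -
    have "integrable M (\<lambda>\<xi>. g i \<xi> * g j \<xi>) \<and>
      expectation (\<lambda>\<xi>. g i \<xi> * g j \<xi>) = (if i = j then expectation (\<lambda>\<xi>. (f (X \<xi>))\<^sup>2) else 0)"
    proof (cases "i = j")
      case True
      then show ?thesis using sqg[of j] expectation_Xs[of "\<lambda>y. (f y)\<^sup>2" j]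
        by (simp add: power2_eq_square g_def)
    next
      case False
      have "indep_vars (\<lambda>_. borel) g {i, j}" by (rule indep_vars_subset[OF indep_g]) simp
      from indep_vars_integrable[OF _ this intg] indep_vars_lebesgue_integral[OF _ this intg] False
      show ?thesis by (simp add: mean_g)
    qed
    then show "integrable M (\<lambda>\<xi>. g i \<xi> * g j \<xi>)"
      "expectation (\<lambda>\<xi>. g i \<xi> * g j \<xi>) = (if i = j then expectation (\<lambda>\<xi>. (f (X \<xi>))\<^sup>2) else 0)"
      by auto
  qed
  have eq: "(sample_mean n (\<lambda>j. f (Xs j \<xi>)))\<^sup>2 = (\<Sum>i<n. \<Sum>j<n. g i \<xi> * g j \<xi>) / (real n)\<^sup>2" for \<xi>
    by (simp add: sample_mean_def power_divide g_def power2_eq_square[of "sum _ _"] sum_product)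
  show "integrable M (\<lambda>\<xi>. (sample_mean n (\<lambda>j. f (Xs j \<xi>)))\<^sup>2)"
    unfolding eq using prod(1) by simp
  show "expectation (\<lambda>\<xi>. (sample_mean n (\<lambda>j. f (Xs j \<xi>)))\<^sup>2) = expectation (\<lambda>\<xi>. (f (X \<xi>))\<^sup>2) / n"
    unfolding eq using prod n by (simp add: power2_eq_square)
qed

text \<open>Centring reduces this to the previous case; the variance is then relaxed to the raw
  second moment, which is easier to bound for the kernels.\<close>

lemma
  fixes f :: "real \<Rightarrow> real"
  assumes n: "0 < n" and f[measurable]: "f \<in> borel_measurable borel"
    and sq: "integrable M (\<lambda>\<xi>. (f (X \<xi>))\<^sup>2)"
  shows integrable_sample_mean_deviation:
      "integrable M (\<lambda>\<xi>. (sample_mean n (\<lambda>j. f (Xs j \<xi>)) - expectation (\<lambda>\<xi>. f (X \<xi>)))\<^sup>2)"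
    and expectation_sample_mean_deviation:
      "expectation (\<lambda>\<xi>. (sample_mean n (\<lambda>j. f (Xs j \<xi>)) - expectation (\<lambda>\<xi>. f (X \<xi>)))\<^sup>2)
        \<le> expectation (\<lambda>\<xi>. (f (X \<xi>))\<^sup>2) / n"
proof -
  define c where "c = expectation (\<lambda>\<xi>. f (X \<xi>))"
  have int: "integrable M (\<lambda>\<xi>. f (X \<xi>))"
    by (rule square_integrable_imp_integrable[OF _ sq]) simp
  have sq': "integrable M (\<lambda>\<xi>. (f (X \<xi>) - c)\<^sup>2)"
    using int sq by (simp add: power2_diff)
  have mean: "expectation (\<lambda>\<xi>. f (X \<xi>) - c) = 0"
    using int by (simp add: c_def prob_space)
  have le: "expectation (\<lambda>\<xi>. (f (X \<xi>) - c)\<^sup>2) \<le> expectation (\<lambda>\<xi>. (f (X \<xi>))\<^sup>2)"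
    using variance_eq[OF int sq] by (simp add: c_def)
  have eq: "sample_mean n (\<lambda>j. f (Xs j \<xi>)) - c = sample_mean n (\<lambda>j. f (Xs j \<xi>) - c)" for \<xi>
    using n by (simp add: sample_mean_linear sample_mean_const)
  show "integrable M (\<lambda>\<xi>. (sample_mean n (\<lambda>j. f (Xs j \<xi>)) - expectation (\<lambda>\<xi>. f (X \<xi>)))\<^sup>2)"
    using integrable_sample_mean_square[OF n _ sq' mean] by (simp flip: c_def add: eq)
  show "expectation (\<lambda>\<xi>. (sample_mean n (\<lambda>j. f (Xs j \<xi>)) - expectation (\<lambda>\<xi>. f (X \<xi>)))\<^sup>2)
        \<le> expectation (\<lambda>\<xi>. (f (X \<xi>))\<^sup>2) / n"
    using expectation_sample_mean_square[OF n _ sq' mean] le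
    by (simp flip: c_def add: eq divide_right_mono)
qed

end

lemma (in iid_sample) prob_sample_mean_ge:
  fixes f :: "real \<Rightarrow> real"
  assumes n: "0 < n" and f[measurable]: "f \<in> borel_measurable borel"
    and sq: "integrable M (\<lambda>\<xi>. (f (X \<xi>))\<^sup>2)" and mean: "expectation (\<lambda>\<xi>. f (X \<xi>)) = 0"
    and a: "0 < a"
  shows "prob {\<xi>\<in>space M. a \<le> \<bar>sample_mean n (\<lambda>j. f (Xs j \<xi>))\<bar>}
    \<le> expectation (\<lambda>\<xi>. (f (X \<xi>))\<^sup>2) / (n * a\<^sup>2)"
proof -
  have "integrable M (\<lambda>\<xi>. f (X \<xi>))"
    by (rule square_integrable_imp_integrable[OF _ sq]) simp
  from expectation_sample_mean[OF n f this] mean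
  have "expectation (\<lambda>\<xi>. sample_mean n (\<lambda>j. f (Xs j \<xi>))) = 0" by simp
  with Chebyshev_inequality[OF _ integrable_sample_mean_square[OF n f sq mean] a]
    expectation_sample_mean_square[OF n f sq mean]
  show ?thesis by simp
qed

text \<open>\<open>concentration\<close> is the form in which the bound on s p(s) enters: the mass
  of |X| on an interval is at most proportional to its length.\<close>

locale standardized_iid_sample = iid_sample +
  fixes B :: real
  assumes moment4: "integrable M (\<lambda>\<xi>. X \<xi> ^ 4)"
    and mean0: "expectation X = 0" and square1: "expectation (\<lambda>\<xi>. (X \<xi>)\<^sup>2) = 1"
    and concentration: "\<And>a b. a \<le> b \<Longrightarrow> expectation (\<lambda>\<xi>. \<bar>X \<xi>\<bar> * indicator {a..b} (X \<xi>)) \<le> B * (b - a)"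
begin

definition m4 :: real where
  "m4 = expectation (\<lambda>\<xi>. (1 + (X \<xi>)\<^sup>2)\<^sup>2)"

lemma square_integrable: "integrable M (\<lambda>\<xi>. (X \<xi>)\<^sup>2)"
  by (rule square_integrable_imp_integrable[OF _])
     (use moment4 in \<open>simp_all add: power_mult[symmetric]\<close>)

lemma X_integrable: "integrable M X"
  by (rule square_integrable_imp_integrable[OF _ square_integrable]) simp

lemma m4_integrable: "integrable M (\<lambda>\<xi>. (1 + (X \<xi>)\<^sup>2)\<^sup>2)"
  using square_integrable moment4 by (simp add: power2_sum power_mult[symmetric])

lemma m4_nonneg: "0 \<le> m4"
  by (simp add: m4_def)

lemma integrable_zb_kernel: "integrable M (\<lambda>\<xi>. zb_kernel t (X \<xi>))"
proof -
  have "zb_kernel t (X \<xi>) = ((X \<xi>)\<^sup>2 - t * X \<xi>) * indicator {..t} (X \<xi>)" for \<xi>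
    by (simp add: zb_kernel_def power2_eq_square algebra_simps)
  moreover have "integrable M (\<lambda>\<xi>. ((X \<xi>)\<^sup>2 - t * X \<xi>) * indicator {\<xi> \<in> space M. X \<xi> \<le> t} \<xi>)"
    using square_integrable X_integrable by (intro integrable_real_mult_indicator) auto
  moreover have "((X \<xi>)\<^sup>2 - t * X \<xi>) * indicator {\<xi> \<in> space M. X \<xi> \<le> t} \<xi>
      = ((X \<xi>)\<^sup>2 - t * X \<xi>) * indicator {..t} (X \<xi>)" if "\<xi> \<in> space M" for \<xi>
    using that by (simp add: indicator_def)
  ultimately show ?thesis by (simp cong: Bochner_Integration.integrable_cong)
qed

lemma zb_cdf_eq: "zb_cdf M X t = expectation (\<lambda>\<xi>. zb_kernel t (X \<xi>))"
  by (simp add: zb_cdf_def zb_kernel_def)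

text \<open>The same argument as for the empirical function, with E X = 0 and E X^2 = 1 in place of
  the sample moments.\<close>

lemma zb_cdf_bounds: "0 \<le> zb_cdf M X t" "zb_cdf M X t \<le> 1"
proof -
  have "0 \<le> zb_cdf M X t \<and> zb_cdf M X t \<le> 1"
  proof (cases "t \<le> 0")
    case True
    have "zb_cdf M X t \<le> expectation (\<lambda>\<xi>. (X \<xi>)\<^sup>2)"
      unfolding zb_cdf_eq using zb_kernel_bounds_nonpos(2)[OF True]
      by (intro integral_mono integrable_zb_kernel square_integrable)
    moreover have "0 \<le> zb_cdf M X t"
      unfolding zb_cdf_eq using zb_kernel_bounds_nonpos(1)[OF True] by (simp add: integral_nonneg_AE)
    ultimately show ?thesis using square1 by simp
  next
    case False
    then have t: "0 \<le> t" by simp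
    have "expectation (\<lambda>\<xi>. - (t * X \<xi>)) \<le> zb_cdf M X t"
      unfolding zb_cdf_eq using zb_kernel_bounds_nonneg(1)[OF t] X_integrable
      by (intro integral_mono integrable_zb_kernel) auto
    moreover have "zb_cdf M X t \<le> expectation (\<lambda>\<xi>. (X \<xi>)\<^sup>2 - t * X \<xi>)"
      unfolding zb_cdf_eq using zb_kernel_bounds_nonneg(2)[OF t] X_integrable square_integrable
      by (intro integral_mono integrable_zb_kernel) auto
    ultimately show ?thesis using X_integrable square_integrable by (simp add: mean0 square1)
  qed
  then show "0 \<le> zb_cdf M X t" "zb_cdf M X t \<le> 1" by auto
qed

lemma integrable_density_kernel: "integrable M (\<lambda>\<xi>. density_kernel t (X \<xi>))"
  by (rule Bochner_Integration.integrable_bound[OF X_integrable]) (use abs_density_kernel_le in auto)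

lemma integrable_tail_kernel: "integrable M (\<lambda>\<xi>. tail_kernel t (X \<xi>))"
proof (rule Bochner_Integration.integrable_bound)
  show "integrable M (\<lambda>\<xi>. \<bar>X \<xi>\<bar> + \<bar>t\<bar>)" using X_integrable by simp
qed (use abs_tail_kernel_le in auto)

lemma expectation_abs_le: "expectation (\<lambda>\<xi>. \<bar>X \<xi>\<bar>) \<le> 1"
proof -
  have "expectation (\<lambda>\<xi>. \<bar>X \<xi>\<bar>) \<le> expectation (\<lambda>\<xi>. (1 + (X \<xi>)\<^sup>2) / 2)"
    using X_integrable square_integrable abs_le_one_plus_square by (intro integral_mono) auto
  then show ?thesis using square_integrable by (simp add: square1 prob_space)
qed

text \<open>Because \<open>X\<close> is centred, the upper and lower truncated means are
  opposite.\<close>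

lemma zb_density_eq: "zb_density M X t = expectation (\<lambda>\<xi>. density_kernel t (X \<xi>))"
proof -
  have "X \<xi> * indicator {t<..} (X \<xi>) = X \<xi> + density_kernel t (X \<xi>)" for \<xi>
    by (simp add: density_kernel_def indicator_def)
  then show ?thesis
    using X_integrable integrable_density_kernel by (simp add: zb_density_def mean0)
qed

lemma abs_zb_density_le: "\<bar>zb_density M X t\<bar> \<le> 1"
proof -
  have "\<bar>zb_density M X t\<bar> \<le> expectation (\<lambda>\<xi>. \<bar>density_kernel t (X \<xi>)\<bar>)"
    unfolding zb_density_eq by (rule integral_abs_bound)
  also have "\<dots> \<le> expectation (\<lambda>\<xi>. \<bar>X \<xi>\<bar>)"
    using integrable_density_kernel X_integrable abs_density_kernel_le by (intro integral_mono) auto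
  finally show ?thesis using expectation_abs_le by simp
qed

lemma abs_expectation_tail_kernel_le: "\<bar>expectation (\<lambda>\<xi>. tail_kernel t (X \<xi>))\<bar> \<le> 1 + \<bar>t\<bar>"
proof -
  have "\<bar>expectation (\<lambda>\<xi>. tail_kernel t (X \<xi>))\<bar> \<le> expectation (\<lambda>\<xi>. \<bar>tail_kernel t (X \<xi>)\<bar>)"
    by (rule integral_abs_bound)
  also have "\<dots> \<le> expectation (\<lambda>\<xi>. \<bar>X \<xi>\<bar> + \<bar>t\<bar>)"
    using integrable_tail_kernel X_integrable abs_tail_kernel_le by (intro integral_mono) auto
  finally show ?thesis using expectation_abs_le X_integrable by (simp add: prob_space)
qed

text \<open>The bound factorizes into a function of y, whose square is integrable by the fourth
  moment, and a function of t, whose square is integrable against the weight. All later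
  integrability and Fubini steps for influence terms rest on this.\<close>

lemma abs_influence2_le: "\<bar>influence2 M X t y\<bar> \<le> 3 * (1 + y\<^sup>2) * (1 + \<bar>t\<bar>)"
proof -
  have y: "\<bar>y\<bar> \<le> (1 + y\<^sup>2) / 2" by (rule abs_le_one_plus_square)
  have ty: "\<bar>t\<bar> * \<bar>y\<bar> \<le> \<bar>t\<bar> * ((1 + y\<^sup>2) / 2)" using y by (intro mult_left_mono) auto
  have 1: "\<bar>zb_kernel t y\<bar> \<le> y\<^sup>2 + \<bar>t\<bar> * \<bar>y\<bar>"
  proof -
    have "\<bar>zb_kernel t y\<bar> \<le> \<bar>y * (y - t)\<bar>" by (auto simp: zb_kernel_def indicator_def)
    also have "\<dots> \<le> y\<^sup>2 + \<bar>t * y\<bar>"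
      using abs_triangle_ineq4[of "y\<^sup>2" "t * y"] by (simp add: power2_eq_square algebra_simps)
    finally show ?thesis by (simp add: abs_mult)
  qed
  have 2: "\<bar>y * expectation (\<lambda>\<xi>. tail_kernel t (X \<xi>))\<bar> \<le> \<bar>y\<bar> * (1 + \<bar>t\<bar>)"
    unfolding abs_mult using abs_expectation_tail_kernel_le by (intro mult_left_mono) auto
  have 3: "\<bar>y\<^sup>2 * zb_cdf M X t\<bar> \<le> y\<^sup>2 * 1"
    unfolding abs_mult using zb_cdf_bounds by (intro mult_mono) auto
  have 4: "\<bar>(1/2 * (1 - y\<^sup>2) * t - y) * zb_density M X t\<bar> \<le> (1 + y\<^sup>2) / 2 * \<bar>t\<bar> + \<bar>y\<bar>"
  proof -
    have "\<bar>(1/2 * (1 - y\<^sup>2) * t - y) * zb_density M X t\<bar> \<le> \<bar>1/2 * (1 - y\<^sup>2) * t - y\<bar> * 1"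
      unfolding abs_mult using abs_zb_density_le by (intro mult_left_mono) auto
    also have "\<dots> \<le> \<bar>1/2 * (1 - y\<^sup>2)\<bar> * \<bar>t\<bar> + \<bar>y\<bar>"
      using abs_triangle_ineq4[of "1/2 * (1 - y\<^sup>2) * t" y] by (simp add: abs_mult)
    also have "\<bar>1/2 * (1 - y\<^sup>2)\<bar> * \<bar>t\<bar> \<le> (1 + y\<^sup>2) / 2 * \<bar>t\<bar>"
      by (intro mult_right_mono) (auto simp: abs_le_iff)
    finally show ?thesis by simp
  qed
  have "\<bar>influence2 M X t y\<bar> \<le> \<bar>zb_kernel t y\<bar> + \<bar>y * expectation (\<lambda>\<xi>. tail_kernel t (X \<xi>))\<bar>
      + \<bar>y\<^sup>2 * zb_cdf M X t\<bar> + \<bar>(1/2 * (1 - y\<^sup>2) * t - y) * zb_density M X t\<bar>"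
    unfolding influence2_def by (rule abs_diff3_le)
  also have "\<dots> \<le> (y\<^sup>2 + \<bar>t\<bar> * \<bar>y\<bar>) + \<bar>y\<bar> * (1 + \<bar>t\<bar>) + y\<^sup>2 * 1 + ((1 + y\<^sup>2) / 2 * \<bar>t\<bar> + \<bar>y\<bar>)"
    using 1 2 3 4 by linarith
  also have "\<dots> = 2 * y\<^sup>2 + 2 * \<bar>y\<bar> + 2 * (\<bar>t\<bar> * \<bar>y\<bar>) + (1 + y\<^sup>2) / 2 * \<bar>t\<bar>" by (simp add: algebra_simps)
  also have "\<dots> \<le> 2 * y\<^sup>2 + (1 + y\<^sup>2) + 2 * (\<bar>t\<bar> * ((1 + y\<^sup>2) / 2)) + (1 + y\<^sup>2) / 2 * \<bar>t\<bar>"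
    using y by (intro add_mono mult_left_mono ty order_refl) auto
  also have "\<dots> \<le> 3 * (1 + y\<^sup>2) * (1 + \<bar>t\<bar>)"
    by (simp add: field_simps)
  finally show ?thesis .
qed

lemma measurable_zb_cdf[measurable]: "zb_cdf M X \<in> borel_measurable borel"
  unfolding zb_cdf_eq[abs_def] by measurable

lemma measurable_zb_density[measurable]: "zb_density M X \<in> borel_measurable borel"
  unfolding zb_density_eq[abs_def] by measurable

lemma measurable_influence2[measurable (raw)]:
  assumes [measurable]: "f \<in> borel_measurable N" "g \<in> borel_measurable N"
  shows "(\<lambda>x. influence2 M X (f x) (g x)) \<in> borel_measurable N"
proof -
  have [measurable]: "(\<lambda>t. expectation (\<lambda>\<xi>. tail_kernel t (X \<xi>))) \<in> borel_measurable borel"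
    by measurable
  show ?thesis unfolding influence2_def by measurable
qed

text \<open>The kernel has mean F^X(t), which cancels E[X^2] F^X(t); the other terms vanish because
  E X = 0 and E[1 - X^2] = 0.\<close>

lemma expectation_influence2: "expectation (\<lambda>\<xi>. influence2 M X t (X \<xi>)) = 0"
  unfolding influence2_def zb_density_eq
  using X_integrable square_integrable integrable_zb_kernel integrable_tail_kernel
  by (simp add: zb_cdf_eq mean0 square1 prob_space)

lemma
  shows integrable_influence2_square: "integrable M (\<lambda>\<xi>. (influence2 M X t (X \<xi>))\<^sup>2)"
    and expectation_influence2_square:
      "expectation (\<lambda>\<xi>. (influence2 M X t (X \<xi>))\<^sup>2) \<le> 9 * m4 * (1 + \<bar>t\<bar>)\<^sup>2"
proof -
  have le: "(influence2 M X t y)\<^sup>2 \<le> 9 * (1 + \<bar>t\<bar>)\<^sup>2 * (1 + y\<^sup>2)\<^sup>2" for y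
    using power_mono[OF abs_influence2_le, of t y 2] unfolding power_mult_distrib by (simp add: ac_simps)
  have int: "integrable M (\<lambda>\<xi>. 9 * (1 + \<bar>t\<bar>)\<^sup>2 * (1 + (X \<xi>)\<^sup>2)\<^sup>2)"
    by (intro integrable_mult_right m4_integrable)
  show 1: "integrable M (\<lambda>\<xi>. (influence2 M X t (X \<xi>))\<^sup>2)"
    by (rule Bochner_Integration.integrable_bound[OF int]) (use le in auto)
  have "expectation (\<lambda>\<xi>. (influence2 M X t (X \<xi>))\<^sup>2)
      \<le> expectation (\<lambda>\<xi>. 9 * (1 + \<bar>t\<bar>)\<^sup>2 * (1 + (X \<xi>)\<^sup>2)\<^sup>2)"
    by (intro integral_mono 1 int le)
  then show "expectation (\<lambda>\<xi>. (influence2 M X t (X \<xi>))\<^sup>2) \<le> 9 * m4 * (1 + \<bar>t\<bar>)\<^sup>2"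
    by (simp add: m4_def ac_simps)
qed

section \<open>Expectation of the remainder bound at a fixed threshold\<close>

lemma lin_bound_nonneg: "0 \<le> \<delta> \<Longrightarrow> 0 \<le> lin_bound M X n x \<delta> t"
  unfolding lin_bound_def sample_mean_def
  by (intro add_nonneg_nonneg mult_nonneg_nonneg divide_nonneg_nonneg sum_nonneg) auto

text \<open>Every summand is of order \<delta>^2: the mass near t is O(\<eta>) by
  \<open>concentration\<close> and carries another factor \<eta>, while squared deviations of sample
  means have expectation O(1 / n).\<close>

lemma
  assumes n: "0 < n" and \<delta>: "0 \<le> \<delta>" "1 / n \<le> \<delta>\<^sup>2"
  shows integrable_lin_bound: "integrable M (\<lambda>\<xi>. lin_bound M X n (\<lambda>j. Xs j \<xi>) \<delta> t)"
    and expectation_lin_bound: "expectation (\<lambda>\<xi>. lin_bound M X n (\<lambda>j. Xs j \<xi>) \<delta> t)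
      \<le> (142 + 112 * B + 108 * m4) * \<delta>\<^sup>2 * (1 + \<bar>t\<bar>)\<^sup>2"
proof -
  define \<tau> where "\<tau> = 1 + \<bar>t\<bar>"
  define \<eta> where "\<eta> = 2 * \<delta> * \<tau>"
  have \<tau>: "1 \<le> \<tau>" "\<tau> \<le> \<tau>\<^sup>2" "1 \<le> \<tau>\<^sup>2" "\<bar>t\<bar> \<le> \<tau>\<^sup>2" "1 + t\<^sup>2 \<le> \<tau>\<^sup>2"
    by (auto simp: \<tau>_def power2_eq_square algebra_simps)
  have \<eta>: "0 \<le> \<eta>" using \<delta> \<tau> by (simp add: \<eta>_def)
  define a where "a \<xi> = sample_mean n (\<lambda>j. \<bar>Xs j \<xi>\<bar> * indicator {t - \<eta>..t + \<eta>} (Xs j \<xi>))" for \<xi>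
  define b where "b \<xi> = (sample_mean n (\<lambda>j. density_kernel t (Xs j \<xi>)) - zb_density M X t)\<^sup>2" for \<xi>
  define c where "c \<xi> = (sample_mean n (\<lambda>j. tail_kernel t (Xs j \<xi>))
      - expectation (\<lambda>\<xi>. tail_kernel t (X \<xi>)))\<^sup>2" for \<xi>
  define d where "d \<xi> = (sample_mean n (\<lambda>j. influence2 M X t (Xs j \<xi>)))\<^sup>2" for \<xi>
  have eq: "lin_bound M X n (\<lambda>j. Xs j \<xi>) \<delta> t
    = 14 * (\<eta> * a \<xi> + \<eta>\<^sup>2 / 2 + b \<xi> / 2 + 3 * \<delta>\<^sup>2 * \<bar>t\<bar> + \<delta>\<^sup>2 / 2 + c \<xi> / 2 + \<delta> * \<eta> + \<delta>\<^sup>2)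
      + 2 * \<delta>\<^sup>2 + 12 * d \<xi>" for \<xi>
    by (simp add: lin_bound_def a_def b_def c_def d_def \<eta>_def \<tau>_def)
  have int_abs: "integrable M (\<lambda>\<xi>. \<bar>X \<xi>\<bar> * indicator {t - \<eta>..t + \<eta>} (X \<xi>))"
    by (rule Bochner_Integration.integrable_bound[OF X_integrable]) (auto simp: indicator_def)
  have a: "integrable M a" "expectation a \<le> 2 * B * \<eta>"
    using integrable_sample_mean[OF n _ int_abs] expectation_sample_mean[OF n _ int_abs]
      concentration[of "t - \<eta>" "t + \<eta>"] \<eta>
    by (simp_all add: a_def[abs_def])
  \<comment> \<open>Trades the rate 1 / n of the variances for the common rate \<delta>^2.\<close>
  have le_n: "r / n \<le> s * \<delta>\<^sup>2" if "r \<le> s" "0 \<le> s" for r s :: real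
  proof -
    have "r / n \<le> s * (1 / n)" using n that by (simp add: divide_right_mono)
    also have "\<dots> \<le> s * \<delta>\<^sup>2" using \<delta> that by (intro mult_left_mono)
    finally show ?thesis .
  qed
  have int_b: "integrable M (\<lambda>\<xi>. (density_kernel t (X \<xi>))\<^sup>2)"
    by (rule Bochner_Integration.integrable_bound[OF square_integrable])
       (use density_kernel_square_le in auto)
  have b: "integrable M b" "expectation b \<le> 1 * \<delta>\<^sup>2"
  proof -
    have "expectation (\<lambda>\<xi>. (density_kernel t (X \<xi>))\<^sup>2) \<le> 1"
      using integral_mono[OF int_b square_integrable density_kernel_square_le] square1 by simp
    then show "integrable M b" "expectation b \<le> 1 * \<delta>\<^sup>2"
      using integrable_sample_mean_deviation[OF n _ int_b]
        order_trans[OF expectation_sample_mean_deviation[OF n _ int_b] le_n[of _ 1]]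
      unfolding b_def[abs_def] zb_density_eq by simp_all
  qed
  have int_dev: "integrable M (\<lambda>\<xi>. (X \<xi> - t)\<^sup>2)" "expectation (\<lambda>\<xi>. (X \<xi> - t)\<^sup>2) = 1 + t\<^sup>2"
    using X_integrable square_integrable by (simp_all add: power2_diff mean0 square1 prob_space)
  have int_c: "integrable M (\<lambda>\<xi>. (tail_kernel t (X \<xi>))\<^sup>2)"
    by (rule Bochner_Integration.integrable_bound[OF int_dev(1)])
       (use tail_kernel_square_le in auto)
  have c: "integrable M c" "expectation c \<le> \<tau>\<^sup>2 * \<delta>\<^sup>2"
  proof -
    have "expectation (\<lambda>\<xi>. (tail_kernel t (X \<xi>))\<^sup>2) \<le> \<tau>\<^sup>2"
      using integral_mono[OF int_c int_dev(1) tail_kernel_square_le] int_dev(2) \<tau>(5) by simp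
    then show "integrable M c" "expectation c \<le> \<tau>\<^sup>2 * \<delta>\<^sup>2"
      using integrable_sample_mean_deviation[OF n _ int_c]
        order_trans[OF expectation_sample_mean_deviation[OF n _ int_c] le_n]
      unfolding c_def[abs_def] by simp_all
  qed
  have d: "integrable M d" "expectation d \<le> 9 * m4 * \<tau>\<^sup>2 * \<delta>\<^sup>2"
    using integrable_sample_mean_square[OF n _ integrable_influence2_square expectation_influence2]
      expectation_sample_mean_square[OF n _ integrable_influence2_square expectation_influence2]
      le_n[OF expectation_influence2_square[of t]] m4_nonneg
    by (simp_all add: d_def[abs_def] \<tau>_def)
  show "integrable M (\<lambda>\<xi>. lin_bound M X n (\<lambda>j. Xs j \<xi>) \<delta> t)"
    unfolding eq using a b c d by simp
  have "expectation (\<lambda>\<xi>. lin_bound M X n (\<lambda>j. Xs j \<xi>) \<delta> t)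
    = 14 * (\<eta> * expectation a + \<eta>\<^sup>2 / 2 + expectation b / 2 + 3 * \<delta>\<^sup>2 * \<bar>t\<bar> + \<delta>\<^sup>2 / 2
        + expectation c / 2 + \<delta> * \<eta> + \<delta>\<^sup>2) + 2 * \<delta>\<^sup>2 + 12 * expectation d"
    unfolding eq using a b c d by (simp add: prob_space)
  also have "\<dots> \<le> 14 * (\<eta> * (2 * B * \<eta>) + \<eta>\<^sup>2 / 2 + 1 * \<delta>\<^sup>2 / 2 + 3 * \<delta>\<^sup>2 * \<tau>\<^sup>2 + \<delta>\<^sup>2 / 2
        + \<tau>\<^sup>2 * \<delta>\<^sup>2 / 2 + 2 * (\<delta>\<^sup>2 * \<tau>\<^sup>2) + \<delta>\<^sup>2) + 2 * \<delta>\<^sup>2 + 12 * (9 * m4 * \<tau>\<^sup>2 * \<delta>\<^sup>2)"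
  proof -
    have 1: "\<eta> * expectation a \<le> \<eta> * (2 * B * \<eta>)" by (rule mult_left_mono[OF a(2) \<eta>])
    have 2: "3 * \<delta>\<^sup>2 * \<bar>t\<bar> \<le> 3 * \<delta>\<^sup>2 * \<tau>\<^sup>2" using \<tau> by (intro mult_left_mono) auto
    have 3: "\<delta> * \<eta> \<le> 2 * (\<delta>\<^sup>2 * \<tau>\<^sup>2)"
      using mult_left_mono[OF \<tau>(2), of "\<delta>\<^sup>2"] by (simp add: \<eta>_def power2_eq_square ac_simps)
    show ?thesis
      by (intro add_mono mult_left_mono[of _ _ "14 :: real"] mult_left_mono[of _ _ "12 :: real"]
          divide_right_mono 1 2 3 b(2) c(2) d(2) order_refl) simp_all
  qed
  \<comment> \<open>With \<eta>^2 = 4 \<delta>^2 \<tau>^2, the coefficients stem in turn from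
    \<open>a\<close>, \<eta>^2 / 2, the |t| term, \<open>c\<close>, \<delta> \<eta> and
    \<open>d\<close>; 30 collects the terms without \<tau>. The numerical constants add up to 135,
    rounded up to 142 below.\<close>
  also have "\<dots> = (112 * B + 28 + 42 + 7 + 28 + 108 * m4) * (\<delta>\<^sup>2 * \<tau>\<^sup>2) + 30 * \<delta>\<^sup>2"
    by (simp add: \<eta>_def power2_eq_square algebra_simps)
  also have "30 * \<delta>\<^sup>2 \<le> 30 * (\<delta>\<^sup>2 * \<tau>\<^sup>2)"
    using mult_left_mono[OF \<tau>(3), of "\<delta>\<^sup>2"] by simp
  also have "(112 * B + 28 + 42 + 7 + 28 + 108 * m4) * (\<delta>\<^sup>2 * \<tau>\<^sup>2) + 30 * (\<delta>\<^sup>2 * \<tau>\<^sup>2)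
      \<le> (142 + 112 * B + 108 * m4) * \<delta>\<^sup>2 * (1 + \<bar>t\<bar>)\<^sup>2"
    by (simp add: \<tau>_def[symmetric] algebra_simps)
  finally show "expectation (\<lambda>\<xi>. lin_bound M X n (\<lambda>j. Xs j \<xi>) \<delta> t)
      \<le> (142 + 112 * B + 108 * m4) * \<delta>\<^sup>2 * (1 + \<bar>t\<bar>)\<^sup>2" by simp
qed

end

section \<open>The weighted statistic\<close>

interpretation std_normal: real_distribution std_normal_distribution
  by (rule real_dist_normal_dist)

lemma measurable_std_normal_cdf[measurable]: "\<Phi> \<in> borel_measurable borel"
  by (intro borel_measurable_mono monoI std_normal.cdf_nondecreasing)

lemma std_normal_cdf_bounds: "0 \<le> \<Phi> t" "\<Phi> t \<le> 1"
  by (rule std_normal.cdf_nonneg std_normal.cdf_bounded_prob)+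

text \<open>The weight function enters as the measure with density w. Finiteness makes bounded
  functions integrable, and the second moment matches the growth (1 + |t|)^2 of the
  remainder.\<close>

locale weighted_sample = standardized_iid_sample + W: finite_measure W for W :: "real measure" +
  assumes sets_W[measurable_cong]: "sets W = sets borel"
    and weight_moment: "integrable W (\<lambda>t. t\<^sup>2)"
begin

sublocale MW: pair_sigma_finite M W ..

definition J :: real where "J = (LINT t|W. (1 + \<bar>t\<bar>)\<^sup>2)"

definition h :: "real \<Rightarrow> real" where "h t = zb_cdf M X t - \<Phi> t"

lemma measurable_h[measurable]: "h \<in> borel_measurable borel"
  unfolding h_def[abs_def] by measurable

lemma abs_h_le: "\<bar>h t\<bar> \<le> 1"
  using zb_cdf_bounds[of t] std_normal_cdf_bounds[of t] by (auto simp: h_def abs_le_iff)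

lemma integrable_weight_square: "integrable W (\<lambda>t. (1 + \<bar>t\<bar>)\<^sup>2)"
proof (rule Bochner_Integration.integrable_bound)
  show "integrable W (\<lambda>t. 2 + 2 * t\<^sup>2)" using weight_moment by simp
  have "(1 + \<bar>t\<bar>)\<^sup>2 \<le> 2 + 2 * t\<^sup>2" for t :: real
    using sum_squares_bound[of 1 "\<bar>t\<bar>"] by (simp add: power2_sum)
  then show "AE t in W. norm ((1 + \<bar>t\<bar>)\<^sup>2) \<le> norm (2 + 2 * t\<^sup>2)" by simp
qed simp

lemma integrable_weight: "integrable W (\<lambda>t. 1 + \<bar>t\<bar>)"
proof (rule Bochner_Integration.integrable_bound[OF integrable_weight_square])
  show "AE t in W. norm (1 + \<bar>t\<bar>) \<le> norm ((1 + \<bar>t\<bar>)\<^sup>2)"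
    by (intro AE_I2) (simp add: power2_eq_square mult_le_cancel_right1 algebra_simps)
qed simp

lemma J_nonneg: "0 \<le> J" by (simp add: J_def)

text \<open>Domination by a product of a function of the observation and one of the threshold, which
  licenses the later exchanges of expectation and weighted integral.\<close>

lemma integrable_pair:
  fixes f :: "'a \<times> real \<Rightarrow> real"
  assumes [measurable]: "f \<in> borel_measurable (M \<Otimes>\<^sub>M W)"
    and bound: "\<And>\<xi> t. \<bar>f (\<xi>, t)\<bar> \<le> c * (1 + (X \<xi>)\<^sup>2)\<^sup>2 * (1 + \<bar>t\<bar>)"
  shows "integrable (M \<Otimes>\<^sub>M W) f"
proof (rule Bochner_Integration.integrable_bound)
  show "integrable (M \<Otimes>\<^sub>M W) (\<lambda>p. c * (1 + (X (fst p))\<^sup>2)\<^sup>2 * (1 + \<bar>snd p\<bar>))"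
  proof (rule MW.Fubini_integrable)
    show "integrable M (\<lambda>\<xi>. LINT t|W. norm (c * (1 + (X (fst (\<xi>, t)))\<^sup>2)\<^sup>2 * (1 + \<bar>snd (\<xi>, t)\<bar>)))"
      using m4_integrable by (simp add: abs_mult)
    show "AE \<xi> in M. integrable W (\<lambda>t. c * (1 + (X (fst (\<xi>, t)))\<^sup>2)\<^sup>2 * (1 + \<bar>snd (\<xi>, t)\<bar>))"
      using integrable_weight by simp
  qed measurable
  show "AE p in M \<Otimes>\<^sub>M W. norm (f p) \<le> norm (c * (1 + (X (fst p))\<^sup>2)\<^sup>2 * (1 + \<bar>snd p\<bar>))"
    using bound by (intro AE_I2) (auto intro: order_trans[OF _ abs_ge_self])
qed measurable

section \<open>The limiting score and its variance\<close>

definition weighted_influence :: "real \<Rightarrow> real \<Rightarrow> real" where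
  "weighted_influence y t = influence2 M X t y * h t"

lemma measurable_weighted_influence[measurable (raw)]:
  assumes [measurable]: "f \<in> borel_measurable N" "g \<in> borel_measurable N"
  shows "(\<lambda>x. weighted_influence (f x) (g x)) \<in> borel_measurable N"
  unfolding weighted_influence_def by measurable

lemma abs_weighted_influence_le: "\<bar>weighted_influence y t\<bar> \<le> 3 * (1 + y\<^sup>2) * (1 + \<bar>t\<bar>)"
  using mult_mono[OF abs_influence2_le abs_h_le, of y t t]
  by (simp add: weighted_influence_def abs_mult)

lemma integrable_weighted_influence: "integrable W (weighted_influence y)"
proof (rule Bochner_Integration.integrable_bound)
  show "integrable W (\<lambda>t. 3 * (1 + y\<^sup>2) * (1 + \<bar>t\<bar>))"
    using integrable_weight by simp
  show "AE t in W. norm (weighted_influence y t) \<le> norm (3 * (1 + y\<^sup>2) * (1 + \<bar>t\<bar>))"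
    using abs_weighted_influence_le[of y] by (intro AE_I2) (auto intro: order_trans[OF _ abs_ge_self])
qed measurable

text \<open>The influence function of the weighted squared distance itself: its derivative at F^X -
  \<Phi> (the factor 2 h) applied to the influence function of F^X.\<close>

definition limit_score :: "real \<Rightarrow> real" where
  "limit_score y = 2 * (LINT t|W. weighted_influence y t)"

lemma measurable_limit_score[measurable]: "limit_score \<in> borel_measurable borel"
  unfolding limit_score_def[abs_def] by measurable

lemma abs_limit_score_le: "\<bar>limit_score y\<bar> \<le> 6 * (LINT t|W. 1 + \<bar>t\<bar>) * (1 + y\<^sup>2)"
proof -
  have "\<bar>LINT t|W. weighted_influence y t\<bar> \<le> (LINT t|W. 3 * (1 + y\<^sup>2) * (1 + \<bar>t\<bar>))"
    using integrable_weight integrable_weighted_influence abs_weighted_influence_le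
    by (intro order_trans[OF integral_abs_bound integral_mono]) auto
  also have "\<dots> = 3 * (1 + y\<^sup>2) * (LINT t|W. 1 + \<bar>t\<bar>)" by simp
  finally show ?thesis by (simp add: limit_score_def abs_mult algebra_simps)
qed

lemma limit_score_square_integrable: "integrable M (\<lambda>\<xi>. (limit_score (X \<xi>))\<^sup>2)"
proof (rule Bochner_Integration.integrable_bound)
  let ?c = "6 * (LINT t|W. 1 + \<bar>t\<bar>)"
  show "integrable M (\<lambda>\<xi>. ?c\<^sup>2 * (1 + (X \<xi>)\<^sup>2)\<^sup>2)" using m4_integrable by (intro integrable_mult_right)
  have "(limit_score y)\<^sup>2 \<le> ?c\<^sup>2 * (1 + y\<^sup>2)\<^sup>2" for y
    using power_mono[OF abs_limit_score_le, of y 2] unfolding power_mult_distrib by simp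
  then show "AE \<xi> in M. norm ((limit_score (X \<xi>))\<^sup>2) \<le> norm (?c\<^sup>2 * (1 + (X \<xi>)\<^sup>2)\<^sup>2)" by simp
qed measurable

lemma expectation_limit_score: "expectation (\<lambda>\<xi>. limit_score (X \<xi>)) = 0"
proof -
  have "integrable (M \<Otimes>\<^sub>M W) (\<lambda>(\<xi>, t). weighted_influence (X \<xi>) t)"
  proof (rule integrable_pair[where c = 3])
    fix \<xi> t
    have "\<bar>weighted_influence (X \<xi>) t\<bar> \<le> 3 * (1 + (X \<xi>)\<^sup>2) * (1 + \<bar>t\<bar>)"
      by (rule abs_weighted_influence_le)
    also have "\<dots> \<le> 3 * (1 + (X \<xi>)\<^sup>2)\<^sup>2 * (1 + \<bar>t\<bar>)"
      by (intro mult_right_mono mult_left_mono one_plus_square_le) auto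
    finally show "\<bar>case (\<xi>, t) of (\<xi>, t) \<Rightarrow> weighted_influence (X \<xi>) t\<bar>
      \<le> 3 * (1 + (X \<xi>)\<^sup>2)\<^sup>2 * (1 + \<bar>t\<bar>)" by simp
  qed measurable
  from MW.Fubini_integral[OF this]
  show ?thesis by (simp add: limit_score_def weighted_influence_def expectation_influence2)
qed

text \<open>This identifies the limit variance with the double integral in the theorem. The square
  is a product of two weighted integrals; they are pulled out one at a time, so that each exchange
  is a Fubini step on \<open>M\<close> and a single copy of \<open>W\<close>.\<close>

lemma expectation_limit_score_square:
  "expectation (\<lambda>\<xi>. (limit_score (X \<xi>))\<^sup>2)
    = 4 * (LINT s|W. LINT t|W. cov_kernel2 M X s t * h s * h t)"
proof -
  define I where "I y = (LINT t|W. weighted_influence y t)" for y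
  have [measurable]: "I \<in> borel_measurable borel" unfolding I_def[abs_def] by measurable
  have I: "\<bar>I y\<bar> \<le> 3 * (LINT t|W. 1 + \<bar>t\<bar>) * (1 + y\<^sup>2)" for y
    using abs_limit_score_le[of y] by (simp add: limit_score_def I_def abs_mult)
  have "integrable (M \<Otimes>\<^sub>M W) (\<lambda>(\<xi>, s). I (X \<xi>) * weighted_influence (X \<xi>) s)"
  proof (rule integrable_pair[where c = "9 * (LINT t|W. 1 + \<bar>t\<bar>)"])
    fix \<xi> s
    have "\<bar>I (X \<xi>) * weighted_influence (X \<xi>) s\<bar>
      \<le> 3 * (LINT t|W. 1 + \<bar>t\<bar>) * (1 + (X \<xi>)\<^sup>2) * (3 * (1 + (X \<xi>)\<^sup>2) * (1 + \<bar>s\<bar>))"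
      unfolding abs_mult by (intro mult_mono I abs_weighted_influence_le) auto
    then show "\<bar>case (\<xi>, s) of (\<xi>, s) \<Rightarrow> I (X \<xi>) * weighted_influence (X \<xi>) s\<bar>
      \<le> 9 * (LINT t|W. 1 + \<bar>t\<bar>) * (1 + (X \<xi>)\<^sup>2)\<^sup>2 * (1 + \<bar>s\<bar>)"
      by (simp add: power2_eq_square[of "1 + _"] algebra_simps)
  qed measurable
  note swap1 = MW.Fubini_integral[OF this]
  have swap2: "(LINT \<xi>|M. I (X \<xi>) * weighted_influence (X \<xi>) s)
      = (LINT t|W. LINT \<xi>|M. weighted_influence (X \<xi>) t * weighted_influence (X \<xi>) s)" for s
  proof -
    have "integrable (M \<Otimes>\<^sub>M W) (\<lambda>(\<xi>, t). weighted_influence (X \<xi>) t * weighted_influence (X \<xi>) s)"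
    proof (rule integrable_pair[where c = "9 * (1 + \<bar>s\<bar>)"])
      fix \<xi> t
      have "\<bar>weighted_influence (X \<xi>) t * weighted_influence (X \<xi>) s\<bar>
        \<le> 3 * (1 + (X \<xi>)\<^sup>2) * (1 + \<bar>t\<bar>) * (3 * (1 + (X \<xi>)\<^sup>2) * (1 + \<bar>s\<bar>))"
        unfolding abs_mult by (intro mult_mono abs_weighted_influence_le) auto
      then show "\<bar>case (\<xi>, t) of (\<xi>, t) \<Rightarrow> weighted_influence (X \<xi>) t * weighted_influence (X \<xi>) s\<bar>
        \<le> 9 * (1 + \<bar>s\<bar>) * (1 + (X \<xi>)\<^sup>2)\<^sup>2 * (1 + \<bar>t\<bar>)"
        by (simp add: power2_eq_square[of "1 + _"] algebra_simps)
    qed measurable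
    from MW.Fubini_integral[OF this] show ?thesis by (simp add: I_def)
  qed
  have "expectation (\<lambda>\<xi>. (limit_score (X \<xi>))\<^sup>2)
      = 4 * (LINT \<xi>|M. LINT s|W. I (X \<xi>) * weighted_influence (X \<xi>) s)"
    by (simp add: limit_score_def power_mult_distrib flip: I_def) (simp add: power2_eq_square)
  also have "\<dots> = 4 * (LINT s|W. LINT t|W. LINT \<xi>|M. weighted_influence (X \<xi>) t * weighted_influence (X \<xi>) s)"
    using swap1 swap2 by simp
  also have "(\<lambda>s. LINT t|W. LINT \<xi>|M. weighted_influence (X \<xi>) t * weighted_influence (X \<xi>) s)
      = (\<lambda>s. LINT t|W. cov_kernel2 M X s t * h s * h t)"
  proof (intro ext Bochner_Integration.integral_cong refl)
    fix s t
    have "weighted_influence (X \<xi>) t * weighted_influence (X \<xi>) s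
      = (influence2 M X s (X \<xi>) * influence2 M X t (X \<xi>)) * (h s * h t)" for \<xi>
      by (simp add: weighted_influence_def ac_simps)
    then show "(LINT \<xi>|M. weighted_influence (X \<xi>) t * weighted_influence (X \<xi>) s)
        = cov_kernel2 M X s t * h s * h t"
      by (simp add: cov_kernel2_def C2_eq_influence2)
  qed
  finally show ?thesis .
qed

section \<open>The remainder integrated against the weight\<close>

lemma measurable_lin_bound[measurable]:
  "(\<lambda>(\<xi>, t). lin_bound M X n (\<lambda>j. Xs j \<xi>) \<delta> t) \<in> borel_measurable (M \<Otimes>\<^sub>M W)"
proof -
  have [measurable]: "(\<lambda>t. expectation (\<lambda>\<xi>. tail_kernel t (X \<xi>))) \<in> borel_measurable borel"
    by measurable
  have [measurable]: "(\<lambda>(\<xi>, t). indicator {t - 2 * \<delta> * (1 + \<bar>t\<bar>)..t + 2 * \<delta> * (1 + \<bar>t\<bar>)} (Xs j \<xi>) :: real)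
      \<in> borel_measurable (M \<Otimes>\<^sub>M W)" for j
    by (measurable, unfold atLeastAtMost_iff, measurable)
  show ?thesis unfolding lin_bound_def by measurable
qed

text \<open>Tonelli's theorem brings the expectation inside, so the bound at each fixed t is enough.
  Nonnegative integrals allow the exchange before joint integrability is known.\<close>

lemma nn_integral_lin_bound:
  assumes n: "0 < n" and \<delta>: "0 \<le> \<delta>" "1 / n \<le> \<delta>\<^sup>2"
  shows "(\<integral>\<^sup>+\<xi>. \<integral>\<^sup>+t. ennreal (lin_bound M X n (\<lambda>j. Xs j \<xi>) \<delta> t) \<partial>W \<partial>M)
    \<le> ennreal ((142 + 112 * B + 108 * m4) * \<delta>\<^sup>2 * J)"
proof -
  let ?C = "(142 + 112 * B + 108 * m4) * \<delta>\<^sup>2"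
  have "(\<integral>\<^sup>+\<xi>. \<integral>\<^sup>+t. ennreal (lin_bound M X n (\<lambda>j. Xs j \<xi>) \<delta> t) \<partial>W \<partial>M)
      = (\<integral>\<^sup>+t. \<integral>\<^sup>+\<xi>. ennreal (lin_bound M X n (\<lambda>j. Xs j \<xi>) \<delta> t) \<partial>M \<partial>W)"
    by (rule MW.Fubini'[symmetric]) measurable
  also have "\<dots> \<le> (\<integral>\<^sup>+t. ennreal (?C * (1 + \<bar>t\<bar>)\<^sup>2) \<partial>W)"
  proof (rule nn_integral_mono)
    fix t
    have "(\<integral>\<^sup>+\<xi>. ennreal (lin_bound M X n (\<lambda>j. Xs j \<xi>) \<delta> t) \<partial>M)
        = ennreal (expectation (\<lambda>\<xi>. lin_bound M X n (\<lambda>j. Xs j \<xi>) \<delta> t))"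
      by (intro nn_integral_eq_integral integrable_lin_bound[OF n \<delta>] AE_I2 lin_bound_nonneg \<delta>(1))
    also have "\<dots> \<le> ennreal (?C * (1 + \<bar>t\<bar>)\<^sup>2)"
      by (intro ennreal_leI expectation_lin_bound[OF n \<delta>])
    finally show "(\<integral>\<^sup>+\<xi>. ennreal (lin_bound M X n (\<lambda>j. Xs j \<xi>) \<delta> t) \<partial>M)
        \<le> ennreal (?C * (1 + \<bar>t\<bar>)\<^sup>2)" .
  qed
  also have "\<dots> = ennreal (LINT t|W. ?C * (1 + \<bar>t\<bar>)\<^sup>2)"
  proof (rule nn_integral_eq_integral)
    show "integrable W (\<lambda>t. ?C * (1 + \<bar>t\<bar>)\<^sup>2)" by (intro integrable_mult_right integrable_weight_square)
    \<comment> \<open>The upper bound is nonnegative because it dominates the expectation of a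
      nonnegative variable.\<close>
    have "0 \<le> expectation (\<lambda>\<xi>. lin_bound M X n (\<lambda>j. Xs j \<xi>) \<delta> t)" for t
      by (intro integral_nonneg_AE AE_I2 lin_bound_nonneg \<delta>(1))
    from order_trans[OF this expectation_lin_bound[OF n \<delta>]]
    show "AE t in W. 0 \<le> ?C * (1 + \<bar>t\<bar>)\<^sup>2" by simp
  qed
  finally show ?thesis by (simp add: J_def)
qed

lemma integrable_bounded:
  fixes f :: "real \<Rightarrow> real"
  assumes [measurable]: "f \<in> borel_measurable borel" and "\<And>t. \<bar>f t\<bar> \<le> c"
  shows "integrable W f"
  by (rule W.integrable_const_bound[of _ c]) (use assms in auto)

text \<open>With D the empirical function minus F^X, the integrand that remains is 2 (D - L) h +
  D^2. Since |h| <= 1, \<open>lin_bound\<close> dominates it. The right side is a nonnegative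
  integral, to which Markov's inequality can be applied directly.\<close>

lemma statistic_linearization:
  assumes n: "0 < n" and \<delta>: "\<delta> \<le> 1/4"
    and m: "\<bar>sample_mean n x\<bar> \<le> \<delta>" and q: "\<bar>sample_mean n (\<lambda>j. (x j)\<^sup>2) - 1\<bar> \<le> \<delta>"
  shows "ennreal \<bar>(LINT t|W. (emp_zb_cdf n x t - \<Phi> t)\<^sup>2) - (LINT t|W. (h t)\<^sup>2)
      - sample_mean n (\<lambda>j. limit_score (x j))\<bar>
    \<le> (\<integral>\<^sup>+t. ennreal (lin_bound M X n x \<delta> t) \<partial>W)"
proof -
  note lin = linearization[OF n \<delta> m q abs_zb_density_le zb_cdf_bounds]
  define L where "L t = sample_mean n (\<lambda>j. influence2 M X t (x j))" for t
  have [measurable]: "L \<in> borel_measurable borel" unfolding L_def[abs_def] by measurable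
  have Lh: "L t * h t = sample_mean n (\<lambda>j. weighted_influence (x j) t)" for t
    by (simp add: L_def weighted_influence_def sample_mean_multc)
  have int_Lh: "integrable W (\<lambda>t. L t * h t)"
    unfolding Lh sample_mean_def using integrable_weighted_influence by simp
  have "2 * (LINT t|W. L t * h t) = sample_mean n (\<lambda>j. limit_score (x j))"
    unfolding Lh unfolding sample_mean_def limit_score_def
    using integrable_weighted_influence by (simp add: sum_distrib_left)
  then have score: "sample_mean n (\<lambda>j. limit_score (x j)) = (LINT t|W. 2 * (L t * h t))"
    by simp
  have [measurable]: "emp_zb_cdf n x \<in> borel_measurable borel" by measurable
  have "\<bar>emp_zb_cdf n x t - \<Phi> t\<bar> \<le> 1" for t
    using emp_zb_cdf_bounds[OF n lin(1), of t] std_normal_cdf_bounds[of t] by (auto simp: abs_le_iff)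
  then have int1: "integrable W (\<lambda>t. (emp_zb_cdf n x t - \<Phi> t)\<^sup>2)"
    by (intro integrable_bounded[where c = 1]) (auto simp: abs_square_le_1)
  have int2: "integrable W (\<lambda>t. (h t)\<^sup>2)"
    using abs_h_le by (intro integrable_bounded[where c = 1]) (auto simp: abs_square_le_1)
  define R where "R t = (emp_zb_cdf n x t - \<Phi> t)\<^sup>2 - (h t)\<^sup>2 - 2 * (L t * h t)" for t
  have int_R: "integrable W R"
    unfolding R_def[abs_def] using int1 int2 int_Lh by simp
  have "(LINT t|W. (emp_zb_cdf n x t - \<Phi> t)\<^sup>2) - (LINT t|W. (h t)\<^sup>2)
      - sample_mean n (\<lambda>j. limit_score (x j)) = (LINT t|W. R t)"
    unfolding score R_def using int1 int2 int_Lh by simp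
  also have "ennreal \<bar>LINT t|W. R t\<bar> \<le> (\<integral>\<^sup>+t. ennreal \<bar>R t\<bar> \<partial>W)"
    using integral_norm_bound_ennreal[OF int_R] by simp
  also have "\<dots> \<le> (\<integral>\<^sup>+t. ennreal (lin_bound M X n x \<delta> t) \<partial>W)"
  proof (intro nn_integral_mono ennreal_leI)
    fix t
    let ?D = "emp_zb_cdf n x t - zb_cdf M X t"
    have "R t = 2 * (?D - L t) * h t + ?D\<^sup>2"
      by (simp add: R_def h_def power2_eq_square algebra_simps)
    also have "\<bar>\<dots>\<bar> \<le> \<bar>2 * (?D - L t) * h t\<bar> + ?D\<^sup>2"
      using abs_triangle_ineq[of "2 * (?D - L t) * h t" "?D\<^sup>2"] by simp
    also have "\<bar>2 * (?D - L t) * h t\<bar> \<le> 2 * \<bar>?D - L t\<bar> * 1"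
      unfolding abs_mult abs_numeral by (intro mult_left_mono abs_h_le) simp
    finally have "\<bar>R t\<bar> \<le> 2 * \<bar>?D - L t\<bar> + ?D\<^sup>2" by simp
    also have "\<dots> \<le> lin_bound M X n x \<delta> t" using lin(2)[of t] by (simp add: L_def)
    finally show "\<bar>R t\<bar> \<le> lin_bound M X n x \<delta> t" .
  qed
  finally show ?thesis .
qed

section \<open>Approximation by a sum of independent scores, and asymptotic normality\<close>

definition statistic :: "nat \<Rightarrow> 'a \<Rightarrow> real" where
  "statistic n \<xi> = sqrt n * ((LINT t|W. (emp_zb_cdf n (\<lambda>j. Xs j \<xi>) t - \<Phi> t)\<^sup>2) - (LINT t|W. (h t)\<^sup>2))"

definition score_sum :: "nat \<Rightarrow> 'a \<Rightarrow> real" where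
  "score_sum n \<xi> = (\<Sum>j<n. limit_score (Xs j \<xi>)) / sqrt n"

lemma measurable_statistic[measurable]: "statistic n \<in> borel_measurable M"
  unfolding statistic_def[abs_def] by measurable

lemma measurable_score_sum[measurable]: "score_sum n \<in> borel_measurable M"
  unfolding score_sum_def[abs_def] by measurable

text \<open>A large difference forces either a failure of the two moment conditions, estimated by
  Chebyshev, or a large integrated remainder, estimated by Markov.\<close>

lemma prob_statistic_minus_score_sum_gt:
  assumes n: "0 < n" and \<delta>: "0 < \<delta>" "\<delta> \<le> 1/4" "1 / n \<le> \<delta>\<^sup>2" and e: "0 < e"
  shows "prob {\<xi>\<in>space M. e < \<bar>statistic n \<xi> - score_sum n \<xi>\<bar>}
    \<le> (1 + m4) / (n * \<delta>\<^sup>2) + (142 + 112 * B + 108 * m4) * J / e * (sqrt n * \<delta>\<^sup>2)"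
proof -
  let ?x = "\<lambda>\<xi> j. Xs j \<xi>"
  define c where "c = (142 + 112 * B + 108 * m4) * \<delta>\<^sup>2 * J"
  define U where "U \<xi> = (\<integral>\<^sup>+t. ennreal (lin_bound M X n (?x \<xi>) \<delta> t) \<partial>W)" for \<xi>
  have [measurable]: "U \<in> borel_measurable M" unfolding U_def[abs_def] by measurable
  define A1 where "A1 = {\<xi>\<in>space M. \<delta> \<le> \<bar>sample_mean n (\<lambda>j. Xs j \<xi>)\<bar>}"
  define A2 where "A2 = {\<xi>\<in>space M. \<delta> \<le> \<bar>sample_mean n (\<lambda>j. (Xs j \<xi>)\<^sup>2 - 1)\<bar>}"
  \<comment> \<open>The event that \<open>sqrt n\<close> times the remainder bound reaches e,
    normalized to the form of Markov's inequality.\<close>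
  define A3 where "A3 = {\<xi>\<in>space M. 1 \<le> ennreal (sqrt n / e) * U \<xi>}"
  have [measurable]: "A1 \<in> events" "A2 \<in> events" "A3 \<in> events"
    unfolding A1_def A2_def A3_def by measurable
  have "prob A1 \<le> 1 / (n * \<delta>\<^sup>2)"
    using prob_sample_mean_ge[OF n _ _ _ \<delta>(1), of "\<lambda>y. y"] square_integrable mean0 square1
    by (simp add: A1_def)
  moreover have "prob A2 \<le> m4 / (n * \<delta>\<^sup>2)"
  proof -
    have le: "(y\<^sup>2 - 1)\<^sup>2 \<le> (1 + y\<^sup>2)\<^sup>2" for y :: real
      by (simp add: abs_le_square_iff[symmetric] abs_le_iff)
    have int: "integrable M (\<lambda>\<xi>. ((X \<xi>)\<^sup>2 - 1)\<^sup>2)"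
      by (rule Bochner_Integration.integrable_bound[OF m4_integrable]) (use le in auto)
    have "expectation (\<lambda>\<xi>. ((X \<xi>)\<^sup>2 - 1)\<^sup>2) \<le> m4"
      unfolding m4_def by (intro integral_mono int m4_integrable le)
    then have "expectation (\<lambda>\<xi>. ((X \<xi>)\<^sup>2 - 1)\<^sup>2) / (n * \<delta>\<^sup>2) \<le> m4 / (n * \<delta>\<^sup>2)"
      by (intro divide_right_mono) auto
    moreover have "expectation (\<lambda>\<xi>. (X \<xi>)\<^sup>2 - 1) = 0"
      using square_integrable by (simp add: square1 prob_space)
    ultimately show ?thesis
      using prob_sample_mean_ge[OF n _ int _ \<delta>(1)] unfolding A2_def by simp
  qed
  moreover have "prob A3 \<le> sqrt n / e * c"
  proof -
    \<comment> \<open>\<open>concentration\<close> on the unit interval forces B to be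
      nonnegative.\<close>
    have "0 \<le> 142 + 112 * B + 108 * m4"
      using order_trans[OF _ concentration[of 0 1]] m4_nonneg by (simp add: integral_nonneg_AE)
    then have c: "0 \<le> c" using J_nonneg by (simp add: c_def)
    have "emeasure M A3 \<le> ennreal (sqrt n / e) * (\<integral>\<^sup>+\<xi>. U \<xi> * indicator (space M) \<xi> \<partial>M)"
      unfolding A3_def by (rule nn_integral_Markov_inequality) auto
    also have "(\<integral>\<^sup>+\<xi>. U \<xi> * indicator (space M) \<xi> \<partial>M) = (\<integral>\<^sup>+\<xi>. U \<xi> \<partial>M)"
      by (intro nn_integral_cong) simp
    also have "ennreal (sqrt n / e) * (\<integral>\<^sup>+\<xi>. U \<xi> \<partial>M) \<le> ennreal (sqrt n / e) * ennreal c"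
      unfolding U_def c_def using \<delta> by (intro mult_left_mono nn_integral_lin_bound n) auto
    also have "\<dots> = ennreal (sqrt n / e * c)"
      by (rule ennreal_mult''[OF c, symmetric])
    finally show ?thesis using c e by (simp add: emeasure_eq_measure)
  qed
  moreover have "{\<xi>\<in>space M. e < \<bar>statistic n \<xi> - score_sum n \<xi>\<bar>} \<subseteq> A1 \<union> A2 \<union> A3"
  proof (intro subsetI, rule ccontr)
    fix \<xi> assume \<xi>: "\<xi> \<in> {\<xi>\<in>space M. e < \<bar>statistic n \<xi> - score_sum n \<xi>\<bar>}" and "\<xi> \<notin> A1 \<union> A2 \<union> A3"
    then have m: "\<bar>sample_mean n (?x \<xi>)\<bar> \<le> \<delta>" and q: "\<bar>sample_mean n (\<lambda>j. (Xs j \<xi>)\<^sup>2) - 1\<bar> \<le> \<delta>"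
      and no3: "\<not> 1 \<le> ennreal (sqrt n / e) * U \<xi>"
      using n by (auto simp: A1_def A2_def A3_def sample_mean_linear sample_mean_const)
    define r where "r = \<bar>(LINT t|W. (emp_zb_cdf n (?x \<xi>) t - \<Phi> t)\<^sup>2) - (LINT t|W. (h t)\<^sup>2)
      - sample_mean n (\<lambda>j. limit_score (Xs j \<xi>))\<bar>"
    have "score_sum n \<xi> = sqrt n * sample_mean n (\<lambda>j. limit_score (Xs j \<xi>))"
      using n by (simp add: score_sum_def sample_mean_def field_simps)
    then have "\<bar>statistic n \<xi> - score_sum n \<xi>\<bar> = sqrt n * r"
      by (simp add: statistic_def r_def abs_mult flip: right_diff_distrib)
    with \<xi> e have "1 \<le> sqrt n / e * r" by (simp add: field_simps)
    then have "1 \<le> ennreal (sqrt n / e) * ennreal r"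
      using e by (simp add: r_def flip: ennreal_mult'')
    also have "\<dots> \<le> ennreal (sqrt n / e) * U \<xi>"
      unfolding r_def U_def by (intro mult_left_mono statistic_linearization n \<delta>(2) m q) simp
    finally show False using no3 by simp
  qed
  then have "prob {\<xi>\<in>space M. e < \<bar>statistic n \<xi> - score_sum n \<xi>\<bar>} \<le> prob (A1 \<union> A2 \<union> A3)"
    by (intro finite_measure_mono) auto
  then have "prob {\<xi>\<in>space M. e < \<bar>statistic n \<xi> - score_sum n \<xi>\<bar>} \<le> prob A1 + prob A2 + prob A3"
    using measure_Un_le[of "A1 \<union> A2" M A3] measure_Un_le[of A1 M A2] by simp
  ultimately have "prob {\<xi>\<in>space M. e < \<bar>statistic n \<xi> - score_sum n \<xi>\<bar>}
      \<le> 1 / (n * \<delta>\<^sup>2) + m4 / (n * \<delta>\<^sup>2) + sqrt n / e * c" by linarith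
  also have "\<dots> = (1 + m4) / (n * \<delta>\<^sup>2) + (142 + 112 * B + 108 * m4) * J / e * (sqrt n * \<delta>\<^sup>2)"
    by (simp add: c_def add_divide_distrib)
  finally show ?thesis .
qed

theorem statistic_weak_conv:
  "weak_conv_m (\<lambda>n. distr M borel (statistic n))
    (normal_law 0 (4 * (LINT s|W. LINT t|W. cov_kernel2 M X s t * h s * h t)))"
proof (rule weak_conv_m_close_in_probability[where A = score_sum])
  let ?v = "4 * (LINT s|W. LINT t|W. cov_kernel2 M X s t * h s * h t)"
  have sq: "integrable M (\<lambda>\<xi>. (limit_score (Xs k \<xi>))\<^sup>2)"
    "expectation (\<lambda>\<xi>. (limit_score (Xs k \<xi>))\<^sup>2) = ?v" for k
    using integrable_Xs_iff[of "\<lambda>y. (limit_score y)\<^sup>2" k] expectation_Xs[of "\<lambda>y. (limit_score y)\<^sup>2" k]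
      limit_score_square_integrable expectation_limit_score_square by simp_all
  have "0 \<le> ?v" by (simp flip: sq(2)[of 0])
  then show "real_distribution (normal_law 0 ?v)" by (rule real_distribution_normal_law)
  have "distr M borel (\<lambda>\<xi>. limit_score (Xs k \<xi>)) = distr (distr M borel (Xs k)) borel limit_score" for k
    by (simp add: distr_distr comp_def)
  then have law: "distr M borel (\<lambda>\<xi>. limit_score (Xs k \<xi>)) = distr (distr M borel X) borel limit_score" for k
    by (simp add: ident)
  show "weak_conv_m (\<lambda>n. distr M borel (score_sum n)) (normal_law 0 ?v)"
    unfolding score_sum_def[abs_def]
    by (rule central_limit_theorem_normal_law[OF indep_vars_compose2[OF indep] _ sq law])
       (simp_all add: expectation_Xs expectation_limit_score)
next
  fix e :: real assume e: "0 < e"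
  \<comment> \<open>For \<delta> = n powr (- a), n \<delta>^2 must tend to infinity, so a < 1/2, and
    sqrt n \<delta>^2 to 0, so a > 1/4. The midpoint 3/8 makes both error terms equally
    small.\<close>
  define \<delta> where "\<delta> n = real n powr (- 3 / 8)" for n
  define bound where "bound n = (1 + m4) * real n powr (- 1 / 4)
    + (142 + 112 * B + 108 * m4) * J / e * real n powr (- 1 / 4)" for n
  have tendsto_powr: "(\<lambda>n. real n powr (- a)) \<longlonglongrightarrow> 0" if "0 < a" for a
    using that by (intro tendsto_neg_powr filterlim_real_sequentially) auto
  have \<delta>: "\<delta> \<longlonglongrightarrow> 0" unfolding \<delta>_def[abs_def] using tendsto_powr[of "3/8"] by simp
  have "bound \<longlonglongrightarrow> (1 + m4) * 0 + (142 + 112 * B + 108 * m4) * J / e * 0"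
    unfolding bound_def[abs_def] using tendsto_powr[of "1/4"]
    by (intro tendsto_add tendsto_mult tendsto_const) simp_all
  then have bound: "bound \<longlonglongrightarrow> 0" by simp
  have le: "\<forall>\<^sub>F n in sequentially. prob {\<xi>\<in>space M. e < \<bar>statistic n \<xi> - score_sum n \<xi>\<bar>} \<le> bound n"
  proof -
    have "\<forall>\<^sub>F n in sequentially. \<delta> n < 1 / 4" using \<delta> by (rule order_tendstoD) simp
    then show ?thesis using eventually_gt_at_top[of 0]
    proof eventually_elim
      case (elim n)
      then have n: "1 \<le> real n" by simp
      have d2: "(\<delta> n)\<^sup>2 = real n powr (- 3 / 4)"
        using n by (simp add: \<delta>_def power2_eq_square flip: powr_add)
      have "1 / real n = real n powr (- 1)" using n by (simp add: powr_minus_divide)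
      also have "\<dots> \<le> (\<delta> n)\<^sup>2" unfolding d2 using n by (intro powr_mono) auto
      finally have inv: "1 / real n \<le> (\<delta> n)\<^sup>2" .
      have "real n * (\<delta> n)\<^sup>2 = real n powr 1 * real n powr (- 3 / 4)" using n by (simp add: d2)
      also have "\<dots> = real n powr (1 / 4)" unfolding powr_add[symmetric] by simp
      finally have nd: "real n * (\<delta> n)\<^sup>2 = real n powr (1 / 4)" .
      have e1: "(1 + m4) / (n * (\<delta> n)\<^sup>2) = (1 + m4) * real n powr (- 1 / 4)"
        unfolding nd using powr_minus_divide[of "real n" "1 / 4"] by simp
      have "sqrt n * (\<delta> n)\<^sup>2 = real n powr (1 / 2) * real n powr (- 3 / 4)"
        using n by (simp add: d2 powr_half_sqrt)
      also have "\<dots> = real n powr (- 1 / 4)" unfolding powr_add[symmetric] by simp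
      finally have e2: "sqrt n * (\<delta> n)\<^sup>2 = real n powr (- 1 / 4)" .
      have "0 < \<delta> n" using n by (simp add: \<delta>_def)
      from prob_statistic_minus_score_sum_gt[OF _ this _ inv e] elim
      show ?case unfolding bound_def e1 e2 by simp
    qed
  qed
  show "(\<lambda>n. prob {\<xi>\<in>space M. e < \<bar>statistic n \<xi> - score_sum n \<xi>\<bar>}) \<longlonglongrightarrow> 0"
    by (rule tendsto_sandwich[OF _ le tendsto_const bound]) simp
qed measurable

end

section \<open>Transfer to the given weight function and density\<close>

theorem corollary3p3:
  fixes M :: "'a measure"
    and X :: "'a \<Rightarrow> real" and Xs :: "nat \<Rightarrow> 'a \<Rightarrow> real"
    and p w :: "real \<Rightarrow> real"
  assumes "prob_space M"
    and w_cont: "continuous_on UNIV w"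
    and w_pos: "\<And>t. 0 < w t"
    and w_int: "integrable lborel (\<lambda>t. t ^ 4 * w t)"
    and indep: "prob_space.indep_vars M (\<lambda>_. borel) (case_nat X Xs) UNIV"
    and ident: "\<And>k. distr M borel (Xs k) = distr M borel X"
    and non_normal: "\<not> (\<exists>\<mu> \<sigma>. 0 < \<sigma> \<and> distributed M lborel X (normal_density \<mu> \<sigma>))"
    and moment4: "integrable M (\<lambda>\<xi>. X \<xi> ^ 4)"
    and p_nonneg: "\<And>s. 0 \<le> p s"
    and p_density: "distributed M lborel X p"
    and p_bound: "bdd_above (range (\<lambda>s. \<bar>s * p s\<bar>))"
    and mean0: "prob_space.expectation M X = 0"
    and var1: "prob_space.variance M X = 1"
  shows "weak_conv_m
     (\<lambda>n. distr M borel
        (\<lambda>\<xi>. sqrt (real n) * (G2 w n (\<lambda>k. Xs k \<xi>) / real n - Delta2 M w X)))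
     (normal_law 0 (tau2_sq M w X))"
proof -
  interpret prob_space M by fact
  have X[measurable]: "X \<in> borel_measurable M"
    using distributed_measurable[OF p_density] by simp
  have indep_Xs: "indep_vars (\<lambda>_. borel) Xs UNIV"
    using indep_vars_reindex[OF inj_Suc indep] by simp
  have p[measurable]: "p \<in> borel_measurable borel"
    using distributed_real_measurable[OF _ p_density] p_nonneg by simp
  obtain B where B: "\<And>s. \<bar>s * p s\<bar> \<le> B"
    using p_bound by (auto simp: bdd_above_def)
  \<comment> \<open>In terms of the density, the integrand |s| p(s) is at most B on an interval of
    length b - a.\<close>
  have concentration: "expectation (\<lambda>\<xi>. \<bar>X \<xi>\<bar> * indicator {a..b} (X \<xi>)) \<le> B * (b - a)"
    if "a \<le> b" for a b
  proof -
    have B0: "0 \<le> B" using B[of 0] by simp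
    have "expectation (\<lambda>\<xi>. \<bar>X \<xi>\<bar> * indicator {a..b} (X \<xi>))
        = (LINT s|lborel. p s * (\<bar>s\<bar> * indicator {a..b} s))"
      by (rule distributed_integral[OF p_density, symmetric]) (use p_nonneg in auto)
    also have "\<dots> \<le> (LINT s|lborel. B * indicator {a..b} s)"
    proof (rule integral_mono_AE')
      show "integrable lborel (\<lambda>s. B * indicator {a..b} s)"
        by (intro integrable_mult_right integrable_real_indicator) (auto simp: emeasure_lborel_Icc_eq)
      show "AE s in lborel. p s * (\<bar>s\<bar> * indicator {a..b} s) \<le> B * indicator {a..b} s"
        using B p_nonneg by (intro AE_I2) (auto simp: indicator_def abs_mult mult.commute)
      show "AE s in lborel. 0 \<le> B * indicator {a..b} s" using B0 by simp
    qed
    also have "\<dots> = B * (b - a)" using that by simp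
    finally show ?thesis .
  qed
  have w[measurable]: "w \<in> borel_measurable borel"
    by (rule borel_measurable_continuous_onI[OF w_cont])
  define W where "W = density lborel w"
  have w0: "0 \<le> w t" for t using w_pos[of t] by simp
  \<comment> \<open>Measurability of f suffices: the two integrands are integrable together, and
    otherwise both integrals take the default value 0.\<close>
  have LINT_W: "(LINT t|W. f t) = (LINT t|lborel. f t * w t)"
    if [measurable]: "f \<in> borel_measurable borel" for f :: "real \<Rightarrow> real"
    unfolding W_def using w0 by (subst integral_real_density) (auto simp: mult.commute)
  \<comment> \<open>Outside [-1, 1] the weight is at most t^4 w(t); near 0, where t^4 gives no
    control, continuity on a compact interval is used.\<close>
  have w_integrable: "integrable lborel w"
  proof -
    have "integrable lborel (\<lambda>t. indicator {-1..1} t *\<^sub>R w t)"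
      by (rule borel_integrable_compact[OF compact_Icc])
         (rule continuous_on_subset[OF w_cont subset_UNIV])
    then have "integrable lborel (\<lambda>t. indicator {-1..1} t *\<^sub>R w t + t ^ 4 * w t)"
      using w_int by simp
    then show ?thesis
    proof (rule Bochner_Integration.integrable_bound)
      have "w t \<le> indicator {-1..1} t * w t + t ^ 4 * w t" for t
      proof (cases "t \<in> {-1..1}")
        case False
        then have "1 \<le> \<bar>t\<bar> ^ 4" by (intro one_le_power) auto
        then have "1 * w t \<le> t ^ 4 * w t" using w0 by (intro mult_right_mono) auto
        then show ?thesis using False by simp
      qed (use w0 in simp)
      then show "AE t in lborel. norm (w t) \<le> norm (indicator {-1..1} t *\<^sub>R w t + t ^ 4 * w t)"
        using w0 by (intro AE_I2) (auto intro: order_trans[OF _ abs_ge_self])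
    qed simp
  qed
  have W_moment: "integrable W (\<lambda>t. t\<^sup>2)"
  proof -
    have "integrable lborel (\<lambda>t. w t + t ^ 4 * w t)" using w_integrable w_int by simp
    then have "integrable lborel (\<lambda>t. w t * t\<^sup>2)"
    proof (rule Bochner_Integration.integrable_bound)
      have "w t * t\<^sup>2 \<le> w t + t ^ 4 * w t" for t
      proof -
        have "2 * t\<^sup>2 \<le> 1 + t ^ 4"
          using sum_squares_bound[of 1 "t\<^sup>2"] by (simp add: power_mult[symmetric])
        then have "t\<^sup>2 \<le> 1 + t ^ 4" using zero_le_power2[of t] by linarith
        from mult_left_mono[OF this w0] show ?thesis by (simp add: algebra_simps)
      qed
      then show "AE t in lborel. norm (w t * t\<^sup>2) \<le> norm (w t + t ^ 4 * w t)"
        using w0 by (intro AE_I2) (auto intro: order_trans[OF _ abs_ge_self])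
    qed simp
    then show ?thesis unfolding W_def using w0 by (subst integrable_real_density) auto
  qed
  interpret W: finite_measure W
  proof (rule finite_measureI)
    have "emeasure W (space W) = (\<integral>\<^sup>+t. ennreal (w t) \<partial>lborel)"
      by (simp add: W_def emeasure_density)
    also have "\<dots> < \<infinity>"
      using w_integrable w0 by (simp add: nn_integral_eq_integral)
    finally show "emeasure W (space W) \<noteq> \<infinity>" by simp
  qed
  have square1: "expectation (\<lambda>\<xi>. (X \<xi>)\<^sup>2) = 1" using var1 mean0 by simp
  have sets_W: "sets W = sets borel" by (simp add: W_def)
  interpret weighted_sample M X Xs B W
    by (unfold_locales; fact X indep_Xs ident moment4 mean0 square1 concentration sets_W W_moment)
  have "G2 w n x / real n = (LINT t|W. (emp_zb_cdf n x t - \<Phi> t)\<^sup>2)" if "0 < n" for n x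
  proof -
    have "(LINT t|W. (emp_zb_cdf n x t - \<Phi> t)\<^sup>2) = (LINT t|lborel. (emp_zb_cdf n x t - \<Phi> t)\<^sup>2 * w t)"
      by (rule LINT_W) measurable
    then show ?thesis
      using that unfolding G2_def emp_zb_cdf_def zb_kernel_def sample_mean_def by simp
  qed
  moreover have "Delta2 M w X = (LINT t|W. (h t)\<^sup>2)"
    unfolding Delta2_def h_def[symmetric] by (rule LINT_W[symmetric]) measurable
  \<comment> \<open>At n = 0 the factor \<open>sqrt n\<close> makes both sides 0, so the two
    sequences agree at every index.\<close>
  ultimately have stat: "sqrt n * (G2 w n (\<lambda>k. Xs k \<xi>) / real n - Delta2 M w X) = statistic n \<xi>" for n \<xi>
    by (cases "n = 0") (simp_all add: statistic_def)
  have tau: "tau2_sq M w X = 4 * (LINT s|W. LINT t|W. cov_kernel2 M X s t * h s * h t)"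
  proof -
    \<comment> \<open>Joint measurability makes the inner integral measurable in s, as the outer
      change of measure requires.\<close>
    have [measurable]: "(\<lambda>(s, t). cov_kernel2 M X s t) \<in> borel_measurable (borel \<Otimes>\<^sub>M borel)"
      unfolding cov_kernel2_def C2_eq_influence2 by measurable
    have "(LINT s|W. LINT t|W. cov_kernel2 M X s t * h s * h t)
        = (LINT s|lborel. (LINT t|W. cov_kernel2 M X s t * h s * h t) * w s)"
      by (rule LINT_W) measurable
    also have "\<dots> = (LINT s|lborel. (LINT t|lborel. cov_kernel2 M X s t * h s * h t * w t) * w s)"
      by (intro Bochner_Integration.integral_cong refl arg_cong2[where f = "(*)"] LINT_W) measurable
    also have "\<dots> = (LINT s|lborel. LINT t|lborel. cov_kernel2 M X s t * h s * h t * w s * w t)"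
      unfolding integral_mult_left_zero[symmetric] by (simp only: mult_ac)
    finally show ?thesis by (simp add: tau2_sq_def h_def)
  qed
  show ?thesis unfolding stat tau by (rule statistic_weak_conv)
qed

end
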